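(* Let $\mathcal{F}_2$ be the class of all $f\in\mathcal{A}$ for which there exists $g\in\mathcal{A}$ with $\bigl|f(z)/g(z)-1\bigr|<1$ and $\operatorname{Re}\bigl(g(z)/(z+z^2/2)\bigr)>0$ for all $z\in\mathbb{D}$. Write $R_{\mathcal{G}}$ for the $\mathcal{G}$-radius $R_{\mathcal{G}}(\mathcal{F}_2)$ of $\mathcal{F}_2$. Then the following (sharp) radii results hold for $\mathcal{F}_2$: (i) For any $0\le\alpha<1$, the radius $R_{\mathcal{S}^*(\alpha)}$ is the smallest positive root of the equation $(3-\alpha)r^3+(2\alpha-1)r^2-(8-\alpha)r+2-2\alpha=0$. (ii) $R_{\mathcal{S}^*_P}=R_{\mathcal{S}^*(1/2)}$ ($\approx 0.1341$). (iii) $R_{\mathcal{S}^*_e}=R_{\mathcal{S}^*(1/e)}$ ($\approx 0.16628$). (iv) $R_{\mathcal{S}^*_{\sin}}=R_{\mathcal{S}^*(1-\sin 1)}$ ($\approx 0.2142$). (v) $R_{\mathcal{S}^*_{\mathrm{lune}}}=R_{\mathcal{S}^*(\sqrt2-1)}$ ($\approx 0.1551$). (vi) $R_{\mathcal{S}^*_R}=R_{\mathcal{S}^*(2(\sqrt2-1))}$ ($\approx 0.0481$). (vii) $R_{\mathcal{S}^*_C}=R_{\mathcal{S}^*(1/3)}$ ($\approx 0.1744$).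
   Context: Notation: $\mathbb{D}_r=\{z\in\mathbb{C}:|z|<r\}$ and $\mathbb{D}=\mathbb{D}_1$. $\mathcal{A}$ is the set of analytic functions $f:\mathbb{D}\to\mathbb{C}$ with $f(0)=0$ and $f'(0)=1$. $\mathcal{S}\subset\mathcal{A}$ is the subclass of univalent (injective) functions. Quotients such as $f(z)/g(z)$ and $g(z)/(z+z^2/2)$ are understood at $z=0$ by their analytic extension (value $1$). For a function $f$, put $s_f(z)=zf'(z)/f(z)$ (with $s_f(0)=1$). For $0\le\alpha<1$, $\mathcal{S}^*(\alpha)$ (starlike functions of order $\alpha$) is the class of $f\in\mathcal{S}$ with $\operatorname{Re}(s_f(z))>\alpha$ for all $z\in\mathbb{D}$. Subordination: for analytic $f,g$ on $\mathbb{D}$, $f\prec g$ means there is an analytic $\omega:\mathbb{D}\to\mathbb{D}$ with $\omega(0)=0$ and $f(z)=g(\omega(z))$ for all $z\in\mathbb{D}$. For an analytic $\varphi$ on $\mathbb{D}$ let $\mathcal{S}^*(\varphi)=\{f\in\mathcal{A}: s_f\prec\varphi\}$. The following special classes are used (principal branches): - $\mathcal{S}^*_e=\mathcal{S}^*(\varphi_2)$ with $\varphi_2(z)=e^z$; - $\mathcal{S}^*_C=\mathcal{S}^*(\varphi_3)$ with $\varphi_3(z)=1+\tfrac43 z+\tfrac23 z^2$; - $\mathcal{S}^*_{\sin}=\mathcal{S}^*(\varphi_4)$ with $\varphi_4(z)=1+\sin z$; - $\mathcal{S}^*_{\mathrm{lune}}=\mathcal{S}^*(\varphi_5)$ with $\varphi_5(z)=z+\sqrt{1+z^2}$;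 - $\mathcal{S}^*_R=\mathcal{S}^*(\varphi_6)$ with $\varphi_6(z)=1+\dfrac{kz+z^2}{k^2-kz}$, $k=\sqrt2+1$; - $\mathcal{S}^*_P=\mathcal{S}^*(\varphi_7)$ with $\varphi_7(z)=1+\dfrac{2}{\pi^2}\Bigl(\log\dfrac{1+\sqrt z}{1-\sqrt z}\Bigr)^2$. Radius: for a class $\mathcal{F}\subset\mathcal{A}$ and a class $\mathcal{G}\subset\mathcal{A}$ characterised by a property, the $\mathcal{G}$-radius $R_{\mathcal{G}}(\mathcal{F})$ is the largest number $R\in[0,1]$ such that every $f\in\mathcal{F}$ has the property defining $\mathcal{G}$ in the disk $\mathbb{D}_r$ for each $0<r<R$; that is, the function $z\mapsto r^{-1}f(rz)$ on $\mathbb{D}$ belongs to $\mathcal{G}$ for each $0<r<R$. "Sharp" means that the stated number is this largest value. The decimal values are approximate numerical values only. *)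

theory Defs
  imports "HOL-Complex_Analysis.Complex_Analysis"
begin

text \<open>
  Functions on the unit disk are total functions on \<^typ>\<open>complex\<close>; every notion below depends
  only on their values on the open unit disk.
\<close>

abbreviation unit_disk :: "complex set" where
  "unit_disk \<equiv> ball 0 1"

definition normalized_analytic :: "(complex \<Rightarrow> complex) set" where
  "normalized_analytic = {f. f holomorphic_on unit_disk \<and> f 0 = 0 \<and> deriv f 0 = 1}"

definition univalent_class :: "(complex \<Rightarrow> complex) set" where
  "univalent_class = {f \<in> normalized_analytic. inj_on f unit_disk}"

text \<open>
  The value 1 at 0 is that of the analytic extension, both for quotients of two normalized
  functions and for the logarithmic derivative \<open>z f'(z) / f(z)\<close>.
\<close>

definition ext_quotient :: "(complex \<Rightarrow> complex) \<Rightarrow> (complex \<Rightarrow> complex) \<Rightarrow> complex \<Rightarrow> complex" where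
  "ext_quotient f g z = (if z = 0 then 1 else f z / g z)"

definition log_deriv :: "(complex \<Rightarrow> complex) \<Rightarrow> complex \<Rightarrow> complex" where
  "log_deriv f z = (if z = 0 then 1 else z * deriv f z / f z)"

definition starlike_of_order :: "real \<Rightarrow> (complex \<Rightarrow> complex) set" where
  "starlike_of_order \<alpha> = {f \<in> univalent_class. \<forall>z\<in>unit_disk. Re (log_deriv f z) > \<alpha>}"

text \<open>
  Subordination is only meaningful between analytic functions, so their analyticity is part of
  the predicate. In particular \<^term>\<open>subordinate (log_deriv f) \<phi>\<close> excludes zeros of \<open>f\<close> other
  than 0: there \<open>z f'(z) / f(z)\<close> has a pole, and division by zero yields a discontinuous function.
\<close>

definition subordinate :: "(complex \<Rightarrow> complex) \<Rightarrow> (complex \<Rightarrow> complex) \<Rightarrow> bool" where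
  "subordinate f g \<longleftrightarrow>
     f holomorphic_on unit_disk \<and> g holomorphic_on unit_disk \<and>
     (\<exists>\<omega>. \<omega> holomorphic_on unit_disk \<and> \<omega> ` unit_disk \<subseteq> unit_disk \<and> \<omega> 0 = 0 \<and>
          (\<forall>z\<in>unit_disk. f z = g (\<omega> z)))"

definition starlike_class :: "(complex \<Rightarrow> complex) \<Rightarrow> (complex \<Rightarrow> complex) set" where
  "starlike_class \<phi> = {f \<in> normalized_analytic. subordinate (log_deriv f) \<phi>}"

definition phi_exp :: "complex \<Rightarrow> complex" where
  "phi_exp z = exp z"

definition phi_cardioid :: "complex \<Rightarrow> complex" where
  "phi_cardioid z = 1 + 4/3 * z + 2/3 * z^2"

definition phi_sin :: "complex \<Rightarrow> complex" where
  "phi_sin z = 1 + sin z"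

definition phi_lune :: "complex \<Rightarrow> complex" where
  "phi_lune z = z + csqrt (1 + z^2)"

definition phi_rational :: "complex \<Rightarrow> complex" where
  "phi_rational z = (let k = complex_of_real (sqrt 2 + 1) in 1 + (k * z + z^2) / (k^2 - k * z))"

text \<open>
  The squared logarithm is even in \<^term>\<open>csqrt z\<close>, so \<open>phi_parabolic\<close> is analytic on the whole
  disk although \<^const>\<open>csqrt\<close> jumps across the negative real axis.
\<close>

definition phi_parabolic :: "complex \<Rightarrow> complex" where
  "phi_parabolic z = 1 + complex_of_real (2 / pi^2) * (Ln ((1 + csqrt z) / (1 - csqrt z)))^2"

definition radius_admissible ::
    "(complex \<Rightarrow> complex) set \<Rightarrow> (complex \<Rightarrow> complex) set \<Rightarrow> real \<Rightarrow> bool" where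
  "radius_admissible G F R \<longleftrightarrow> 0 \<le> R \<and> R \<le> 1 \<and>
     (\<forall>f\<in>F. \<forall>r. 0 < r \<and> r < R \<longrightarrow> (\<lambda>z. f (of_real r * z) / of_real r) \<in> G)"

definition radius :: "(complex \<Rightarrow> complex) set \<Rightarrow> (complex \<Rightarrow> complex) set \<Rightarrow> real" where
  "radius G F = (GREATEST R. radius_admissible G F R)"

text \<open>The greatest admissible number always exists, so \<^const>\<open>radius\<close> is never a junk value.\<close>

lemma radius_greatest:
  shows radius_admissible_radius: "radius_admissible G F (radius G F)"
    and radius_upper: "radius_admissible G F R \<Longrightarrow> R \<le> radius G F"
proof -
  define A where "A = {R. radius_admissible G F R}"
  have bdd: "bdd_above A"
    by (rule bdd_aboveI[of _ 1]) (simp add: A_def radius_admissible_def)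
  have zero: "0 \<in> A"
    by (auto simp: A_def radius_admissible_def)
  have upper: "R \<le> Sup A" if "radius_admissible G F R" for R
    using bdd that by (simp add: A_def cSup_upper)
  have adm: "radius_admissible G F (Sup A)"
    unfolding radius_admissible_def
  proof (intro conjI ballI allI impI)
    show "0 \<le> Sup A"
      using cSup_upper[OF zero bdd] .
    show "Sup A \<le> 1"
      by (rule cSup_least) (use zero in blast, simp add: A_def radius_admissible_def)
    fix f r assume "f \<in> F" and r: "0 < r \<and> r < Sup A"
    then obtain R where "R \<in> A" "r < R"
      using zero bdd less_cSup_iff[of A r] by blast
    then show "(\<lambda>z. f (of_real r * z) / of_real r) \<in> G"
      using \<open>f \<in> F\<close> r by (simp add: A_def radius_admissible_def)
  qed
  have eq: "radius G F = Sup A"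
    unfolding radius_def using adm upper by (rule Greatest_equality)
  show "radius_admissible G F (radius G F)"
    using adm eq by simp
  show "R \<le> radius G F" if "radius_admissible G F R"
    using upper[OF that] eq by simp
qed

definition smallest_positive_root :: "(real \<Rightarrow> real) \<Rightarrow> real \<Rightarrow> bool" where
  "smallest_positive_root p r \<longleftrightarrow> 0 < r \<and> p r = 0 \<and> (\<forall>s. 0 < s \<and> p s = 0 \<longrightarrow> r \<le> s)"

definition class_F2 :: "(complex \<Rightarrow> complex) set" where
  "class_F2 = {f \<in> normalized_analytic. \<exists>g\<in>normalized_analytic. \<forall>z\<in>unit_disk.
     norm (ext_quotient f g z - 1) < 1 \<and> Re (ext_quotient g (\<lambda>z. z + z^2 / 2) z) > 0}"

end

theory Submission
  imports Defs
begin

text \<open>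
  Writing \<open>f = h p (z + z\<^sup>2/2)\<close> with \<open>\<bar>h - 1\<bar> < 1\<close> and \<open>Re p > 0\<close>, the Schwarz-Pick inequality
  bounds \<open>\<bar>z f'(z)/f(z) - 1\<bar>\<close> on \<open>\<bar>z\<bar> = r\<close> by \<open>r/(1-r) + 2r/(1-r\<^sup>2) + r/(2-r)\<close>, with equality at
  \<open>z = -r\<close> for \<open>f = z (1 + z/2) (1 + z)\<^sup>2 / (1 - z)\<close>. This bound is less than \<open>1 - \<alpha>\<close> exactly when
  the cubic is positive. So a class has radius equal to the first root as soon as it contains
  every \<open>f\<close> whose logarithmic derivative lies in the disk \<open>D(1, 1 - \<alpha>)\<close> and none of its members
  has logarithmic derivative taking the value \<open>\<alpha>\<close>. For a class given by subordination to \<open>\<phi>\<close>, this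
  means that \<open>\<phi>\<close> omits \<open>\<alpha> = \<phi>(-1)\<close> and has a holomorphic right inverse on \<open>D(1, 1 - \<alpha>)\<close>.
\<close>

section \<open>Schwarz-Pick estimates for logarithmic derivatives\<close>

text \<open>Disk automorphisms move \<open>a\<close> and \<open>\<omega> a\<close> to the origin,
  where the bound is the derivative part of the Schwarz lemma. The two factors come from the
  derivatives of these automorphisms.\<close>

lemma schwarz_pick:
  assumes hol: "\<omega> holomorphic_on ball 0 1"
    and lt: "\<And>z. norm z < 1 \<Longrightarrow> norm (\<omega> z) < 1" and a: "norm a < 1"
  shows "norm (deriv \<omega> a) * (1 - (norm a)\<^sup>2) \<le> 1 - (norm (\<omega> a))\<^sup>2"
proof -
  define b where "b = \<omega> a"
  have b: "norm b < 1" using lt[OF a] by (simp add: b_def)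
  \<comment> \<open>The inner Moebius map sends 0 to \<open>a\<close>, the outer one sends
    \<open>b\<close> to 0.\<close>
  define \<Phi> where "\<Phi> \<zeta> = Moebius_function 0 b (\<omega> (Moebius_function 0 (-a) \<zeta>))" for \<zeta>
  have na: "norm (-a) < 1" using a by simp
  have M1: "Moebius_function 0 (-a) ` ball 0 1 \<subseteq> ball 0 1"
    using Moebius_function_norm_lt_1[OF na] by auto
  have holP: "\<Phi> holomorphic_on ball 0 1"
    unfolding \<Phi>_def
    by (rule holomorphic_on_compose_gen[OF holomorphic_on_compose_gen[OF
          Moebius_function_holomorphic[OF na] hol M1] Moebius_function_holomorphic[OF b], unfolded o_def])
      (use Moebius_function_norm_lt_1[OF na] lt in auto)
  have P0: "\<Phi> 0 = 0"
    by (simp add: \<Phi>_def Moebius_function_simple b_def)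
  have Plt: "norm (\<Phi> z) < 1" if "norm z < 1" for z
    unfolding \<Phi>_def by (intro Moebius_function_norm_lt_1 b lt na that)
  have le1: "norm (deriv \<Phi> 0) \<le> 1"
    using Schwarz_Lemma(2)[OF holP P0 Plt, of 0] by simp
  have na2: "complex_of_real (1 - (norm a)\<^sup>2) = 1 - a * cnj a"
    and nb2: "complex_of_real (1 - (norm b)\<^sup>2) = 1 - b * cnj b"
    using complex_norm_square[of a] complex_norm_square[of b] by simp_all
  have pos: "1 - (norm a)\<^sup>2 > 0" "1 - (norm b)\<^sup>2 > 0"
    using a b by (auto simp: power_less_one_iff abs_square_less_1)
  have nz: "1 - cnj b * b \<noteq> 0"
    using pos(2) nb2 by (metis less_irrefl mult.commute of_real_eq_0_iff)
  have d1: "(Moebius_function 0 (-a) has_field_derivative of_real (1 - (norm a)\<^sup>2)) (at 0)"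
    unfolding Moebius_function_simple[abs_def] na2
    by (auto intro!: derivative_eq_intros simp: mult.commute)
  have d2: "(\<omega> has_field_derivative deriv \<omega> a) (at (Moebius_function 0 (-a) 0))"
    using holomorphic_derivI[OF hol open_ball, of a] a by (simp add: Moebius_function_simple)
  have d3: "(Moebius_function 0 b has_field_derivative 1 / of_real (1 - (norm b)\<^sup>2))
              (at (\<omega> (Moebius_function 0 (-a) 0)))"
    unfolding Moebius_function_simple[abs_def] nb2 using nz
    by (auto intro!: derivative_eq_intros simp: mult.commute b_def[symmetric] divide_simps)
  have "(\<Phi> has_field_derivative
      1 / of_real (1 - (norm b)\<^sup>2) * (deriv \<omega> a * of_real (1 - (norm a)\<^sup>2))) (at 0)"
    unfolding \<Phi>_def by (rule DERIV_chain2[OF d3 DERIV_chain2[OF d2 d1]])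
  hence "deriv \<Phi> 0 = 1 / of_real (1 - (norm b)\<^sup>2) * (deriv \<omega> a * of_real (1 - (norm a)\<^sup>2))"
    by (rule DERIV_imp_deriv)
  hence "norm (deriv \<Phi> 0) = norm (deriv \<omega> a) * (1 - (norm a)\<^sup>2) / (1 - (norm b)\<^sup>2)"
    using pos by (simp add: norm_mult norm_divide del: of_real_diff of_real_power)
  hence "norm (deriv \<omega> a) * (1 - (norm a)\<^sup>2) = norm (deriv \<Phi> 0) * (1 - (norm b)\<^sup>2)"
    using pos by simp
  also have "\<dots> \<le> 1 * (1 - (norm b)\<^sup>2)" by (intro mult_right_mono le1) (use pos in simp)
  finally show ?thesis by (simp add: b_def)
qed

lemma Re_cayley_pos:
  assumes "norm z < 1"
  shows "Re ((1 + z) / (1 - z)) > 0"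
proof -
  have "(Re z)\<^sup>2 + (Im z)\<^sup>2 < 1"
    using assms by (metis cmod_power2 norm_ge_zero power_less_one_iff zero_less_numeral)
  hence "(1 + Re z) * (1 - Re z) - Im z * Im z > 0"
    by (simp add: power2_eq_square algebra_simps)
  moreover have "Re ((1 + z) / (1 - z))
      = ((1 + Re z) * (1 - Re z) - Im z * Im z) / (norm (1 - z))\<^sup>2"
    by (simp add: Re_divide cmod_power2)
  moreover have "1 - z \<noteq> 0" using assms by auto
  ultimately show ?thesis by simp
qed

lemma norm_cayley_less_1:
  assumes "Re p > 0"
  shows "norm ((p - 1) / (p + 1)) < 1"
proof -
  have "(norm (p + 1))\<^sup>2 - (norm (p - 1))\<^sup>2 = 4 * Re p"
    unfolding cmod_power2 by (simp add: algebra_simps power2_eq_square)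
  hence "(norm (p - 1))\<^sup>2 < (norm (p + 1))\<^sup>2" using assms by linarith
  hence "norm (p - 1) < norm (p + 1)" by (rule power2_less_imp_less) simp
  moreover have "p + 1 \<noteq> 0" using assms by (auto simp: complex_eq_iff)
  ultimately show ?thesis by (simp add: norm_divide)
qed

text \<open>Schwarz-Pick is applied to the Cayley transform \<open>\<omega>\<close> of
  \<open>p\<close>. Since |p + 1|^2 - |p - 1|^2 = 4 Re p, the denominator |p + 1|^2 cancels and
  leaves |p'| (1 - |z|^2) \<le> 2 Re p \<le> 2 |p|.\<close>

lemma norm_log_deriv_positive_real_part:
  assumes hol: "p holomorphic_on ball 0 1" and re: "\<And>z. norm z < 1 \<Longrightarrow> Re (p z) > 0"
    and z: "norm z < 1"
  shows "norm (z * deriv p z / p z) \<le> 2 * norm z / (1 - (norm z)\<^sup>2)"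
proof -
  define \<omega> where "\<omega> z = (p z - 1) / (p z + 1)" for z
  have nz: "p z + 1 \<noteq> 0" "p z \<noteq> 0" if "norm z < 1" for z
    using re[OF that] by (auto simp: complex_eq_iff)
  have sq: "(norm (p z + 1))\<^sup>2 - (norm (p z - 1))\<^sup>2 = 4 * Re (p z)" for z
    unfolding cmod_power2 by (simp add: algebra_simps power2_eq_square)
  have lt: "norm (\<omega> z) < 1" if "norm z < 1" for z
    using norm_cayley_less_1[OF re[OF that]] by (simp add: \<omega>_def)
  have holw: "\<omega> holomorphic_on ball 0 1"
    unfolding \<omega>_def by (intro holomorphic_intros hol) (use nz in auto)
  have dp: "(p has_field_derivative deriv p z) (at z)"
    using holomorphic_derivI[OF hol open_ball, of z] z by simp
  have "(\<omega> has_field_derivative (2 * deriv p z / (p z + 1)\<^sup>2)) (at z)"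
    unfolding \<omega>_def by (rule derivative_eq_intros dp refl)+
      (use nz[OF z] in \<open>auto simp: divide_simps power2_eq_square algebra_simps\<close>)
  hence dw: "deriv \<omega> z = 2 * deriv p z / (p z + 1)\<^sup>2" by (rule DERIV_imp_deriv)
  have pos: "1 - (norm z)\<^sup>2 > 0" using z by (auto simp: power_less_one_iff abs_square_less_1)
  define N where "N = (norm (p z + 1))\<^sup>2"
  have N: "N > 0" using nz[OF z] by (simp add: N_def)
  have "2 * norm (deriv p z) / N * (1 - (norm z)\<^sup>2) \<le> 1 - (norm (p z - 1))\<^sup>2 / N"
    using schwarz_pick[OF holw lt z]
    unfolding dw by (simp add: \<omega>_def norm_divide norm_mult norm_power power_divide N_def)
  also have "\<dots> = 4 * Re (p z) / N"
    unfolding sq[of z, symmetric] N_def[symmetric] using N by (simp add: diff_divide_distrib)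
  finally have "(2 * norm (deriv p z) * (1 - (norm z)\<^sup>2)) / N \<le> (4 * Re (p z)) / N"
    by simp
  hence "norm (deriv p z) * (1 - (norm z)\<^sup>2) \<le> 2 * Re (p z)"
    unfolding divide_le_cancel using N by linarith
  also have "\<dots> \<le> 2 * norm (p z)" using complex_Re_le_cmod[of "p z"] by simp
  finally have "norm (deriv p z) * (1 - (norm z)\<^sup>2) \<le> 2 * norm (p z)" .
  hence "norm (deriv p z) / norm (p z) \<le> 2 / (1 - (norm z)\<^sup>2)"
    using pos nz(2)[OF z] by (simp add: field_simps)
  hence "norm z * (norm (deriv p z) / norm (p z)) \<le> norm z * (2 / (1 - (norm z)\<^sup>2))"
    by (rule mult_left_mono) simp
  thus ?thesis by (simp add: norm_mult norm_divide mult.commute)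
qed

text \<open>Here \<open>\<omega>\<close> = h - 1 fixes 0, so the Schwarz lemma bounds |h - 1| by
  |z|. Combined with Schwarz-Pick this controls h' and keeps h away from 0.\<close>

lemma norm_log_deriv_near_one:
  assumes hol: "h holomorphic_on ball 0 1" and h0: "h 0 = 1"
    and lt: "\<And>z. norm z < 1 \<Longrightarrow> norm (h z - 1) < 1" and z: "norm z < 1"
  shows "norm (z * deriv h z / h z) \<le> norm z / (1 - norm z)"
proof -
  define \<omega> where "\<omega> z = h z - 1" for z
  have holw: "\<omega> holomorphic_on ball 0 1"
    unfolding \<omega>_def by (intro holomorphic_intros hol)
  have lt': "norm (\<omega> z) < 1" if "norm z < 1" for z using lt[OF that] by (simp add: \<omega>_def)
  have dh: "(h has_field_derivative deriv h z) (at z)"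
    using holomorphic_derivI[OF hol open_ball, of z] z by simp
  have "(\<omega> has_field_derivative deriv h z) (at z)"
    unfolding \<omega>_def by (rule derivative_eq_intros dh refl)+ simp
  hence dw: "deriv \<omega> z = deriv h z" by (rule DERIV_imp_deriv)
  define r s where "r = norm z" and "s = norm (\<omega> z)"
  have s: "s \<le> r" "0 \<le> s" "r < 1"
    using Schwarz_Lemma(1)[OF holw _ lt' z] z by (auto simp: \<omega>_def h0 r_def s_def)
  have hs: "norm (h z) \<ge> 1 - s"
    using norm_triangle_ineq2[of 1 "- \<omega> z"] unfolding norm_minus_cancel by (simp add: \<omega>_def s_def)
  have r2: "(1 - r) * (1 + r) = 1 - r\<^sup>2" by (simp add: power2_eq_square algebra_simps)
  have "norm (deriv h z) * ((1 - r) * (1 + r)) \<le> (1 - s) * (1 + s)"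
    using schwarz_pick[OF holw lt' z] unfolding dw r_def[symmetric] s_def[symmetric] r2
    by (simp add: power2_eq_square algebra_simps)
  \<comment> \<open>The factor 1 - s is at most |h|, and 1 + s is at most 1 + r; the factor 1 + r
    then cancels.\<close>
  also have "\<dots> \<le> norm (h z) * (1 + r)"
    using hs s by (intro mult_mono) auto
  finally have "norm (deriv h z) * (1 - r) \<le> norm (h z)"
    using s by simp
  moreover have "norm (h z) > 0" using hs s by linarith
  ultimately have "norm (deriv h z) / norm (h z) \<le> 1 / (1 - r)"
    using s by (simp add: field_simps)
  hence "r * (norm (deriv h z) / norm (h z)) \<le> r * (1 / (1 - r))"
    by (rule mult_left_mono) (use s in auto)
  thus ?thesis by (simp add: norm_mult norm_divide r_def)
qed

section \<open>Normalized functions and the bound for the class\<close>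

text \<open>The difference quotient at 0 has a removable singularity. Working with \<open>F\<close>
  instead of \<open>f\<close> makes the quotients between normalized functions regular at 0.\<close>

lemma normalized_analytic_factor:
  assumes "f \<in> normalized_analytic"
  obtains F where "F holomorphic_on unit_disk" "F 0 = 1" "\<And>z. f z = z * F z"
proof -
  define F where "F z = (if z = 0 then deriv f 0 else (f z - f 0) / (z - 0))" for z
  have "F holomorphic_on unit_disk"
    unfolding F_def using assms
    by (intro pole_lemma_open) (auto simp: normalized_analytic_def)
  moreover have "F 0 = 1" "\<And>z. f z = z * F z"
    using assms by (auto simp: F_def normalized_analytic_def)
  ultimately show ?thesis using that by blast
qed

lemma has_field_derivative_times_id:
  assumes "F holomorphic_on unit_disk" "\<And>z. z \<in> unit_disk \<Longrightarrow> f z = z * F z" "z \<in> unit_disk"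
  shows "(f has_field_derivative (F z + z * deriv F z)) (at z)"
proof -
  have "(F has_field_derivative deriv F z) (at z)"
    using holomorphic_derivI[OF assms(1) open_ball assms(3)] .
  hence "((\<lambda>z. z * F z) has_field_derivative (F z + z * deriv F z)) (at z)"
    by (auto intro!: derivative_eq_intros)
  thus ?thesis
    by (rule has_field_derivative_transform_within_open[OF _ open_ball assms(3)])
       (use assms(2) in auto)
qed

text \<open>The right-hand side is also correct at 0, where \<open>log_deriv\<close> has the value 1
  by definition; it needs no case distinction and is visibly analytic.\<close>

lemma log_deriv_factor:
  assumes "F holomorphic_on unit_disk" "\<And>z. z \<in> unit_disk \<Longrightarrow> f z = z * F z"
    "z \<in> unit_disk" "F z \<noteq> 0"
  shows "log_deriv f z = 1 + z * deriv F z / F z"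
  using DERIV_imp_deriv[OF has_field_derivative_times_id[OF assms(1-3)]] assms(2-4)
  by (auto simp: log_deriv_def field_simps)

lemma normalized_analyticI:
  assumes "F holomorphic_on unit_disk" "\<And>z. z \<in> unit_disk \<Longrightarrow> f z = z * F z" "F 0 = 1"
  shows "f \<in> normalized_analytic"
proof -
  have "f holomorphic_on unit_disk"
    using has_field_derivative_times_id[OF assms(1,2)]
    by (metis holomorphic_on_open open_ball)
  moreover have "deriv f 0 = 1"
    using DERIV_imp_deriv[OF has_field_derivative_times_id[OF assms(1,2), of 0]] assms(3) by simp
  ultimately show ?thesis
    using assms(2)[of 0] by (simp add: normalized_analytic_def)
qed

lemma log_deriv_holomorphic:
  assumes "f \<in> normalized_analytic" "\<And>z. z \<in> unit_disk \<Longrightarrow> z \<noteq> 0 \<Longrightarrow> f z \<noteq> 0"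
  shows "log_deriv f holomorphic_on unit_disk"
proof -
  obtain F where F: "F holomorphic_on unit_disk" "F 0 = 1" "\<And>z. f z = z * F z"
    using normalized_analytic_factor[OF assms(1)] by blast
  have nz: "F z \<noteq> 0" if "z \<in> unit_disk" for z
    using assms(2)[OF that] F(2,3) by (cases "z = 0") auto
  have "(\<lambda>z. 1 + z * deriv F z / F z) holomorphic_on unit_disk"
    by (intro holomorphic_intros F holomorphic_deriv nz open_ball)
  thus ?thesis
    by (rule holomorphic_transform) (use log_deriv_factor[OF F(1,3)] nz in auto)
qed

text \<open>In f = z H P (1 + z/2) the logarithmic derivatives add up, and each summand of the bound
  belongs to one of the last three factors.\<close>

lemma class_F2_log_deriv_bound:
  assumes f: "f \<in> class_F2" and z: "z \<in> unit_disk"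
  shows "z \<noteq> 0 \<Longrightarrow> f z \<noteq> 0"
    and "norm (log_deriv f z - 1) \<le>
      norm z / (1 - norm z) + 2 * norm z / (1 - (norm z)\<^sup>2) + norm z / (2 - norm z)"
proof -
  obtain g where fn: "f \<in> normalized_analytic" and gn: "g \<in> normalized_analytic"
    and h: "\<And>z. z \<in> unit_disk \<Longrightarrow> norm (ext_quotient f g z - 1) < 1"
    and p: "\<And>z. z \<in> unit_disk \<Longrightarrow> Re (ext_quotient g (\<lambda>z. z + z\<^sup>2 / 2) z) > 0"
    using f by (auto simp: class_F2_def)
  obtain F where F: "F holomorphic_on unit_disk" "F 0 = 1" "\<And>z. f z = z * F z"
    using normalized_analytic_factor[OF fn] by blast
  obtain G where G: "G holomorphic_on unit_disk" "G 0 = 1" "\<And>z. g z = z * G z"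
    using normalized_analytic_factor[OF gn] by blast
  have k: "1 + z / 2 \<noteq> 0" if "z \<in> unit_disk" for z :: complex
  proof
    assume "1 + z / 2 = 0"
    hence "z = -2" by (simp add: eq_neg_iff_add_eq_0 field_simps)
    thus False using that by simp
  qed
  \<comment> \<open>A zero of \<open>f\<close> or of \<open>g\<close> other than 0 would make f/g
    equal to 0, by the convention x/0 = 0 in the second case, and then |f/g - 1| would be 1.\<close>
  have FG: "F z \<noteq> 0 \<and> G z \<noteq> 0" if "z \<in> unit_disk" for z
    using h[OF that] F(2,3) G(2,3) by (cases "z = 0"; auto simp: ext_quotient_def)
  define H P where "H z = F z / G z" and "P z = G z / (1 + z / 2)" for z
  have hH: "ext_quotient f g z = H z" for z
    by (auto simp: ext_quotient_def H_def F(2,3) G(2,3))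
  have pP: "ext_quotient g (\<lambda>z. z + z\<^sup>2 / 2) z = P z" for z
  proof (cases "z = 0")
    case False
    have "z + z\<^sup>2 / 2 = z * (1 + z / 2)" by (simp add: power2_eq_square algebra_simps)
    thus ?thesis using False by (simp add: ext_quotient_def P_def G(3))
  qed (simp add: ext_quotient_def P_def G(2))
  have holH: "H holomorphic_on unit_disk" unfolding H_def
    by (intro holomorphic_intros F G) (use FG in auto)
  have holP: "P holomorphic_on unit_disk" unfolding P_def
    by (intro holomorphic_intros G) (use k in auto)
  show "z \<noteq> 0 \<Longrightarrow> f z \<noteq> 0" using FG[OF z] F(3) by simp
  have nz: "H z \<noteq> 0" "P z \<noteq> 0" "1 + z/2 \<noteq> 0"
    using FG[OF z] k[OF z] by (auto simp: H_def P_def)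
  have FHP: "F w = H w * (P w * (1 + w / 2))" if "w \<in> unit_disk" for w
    using FG[OF that] k[OF that] by (simp add: H_def P_def)
  have dH: "(H has_field_derivative deriv H z) (at z)"
    and dP: "(P has_field_derivative deriv P z) (at z)"
    using holomorphic_derivI[OF holH open_ball z] holomorphic_derivI[OF holP open_ball z] .
  have dk: "((\<lambda>w. 1 + w / 2) has_field_derivative 1/2) (at z)"
    by (auto intro!: derivative_eq_intros)
  have "((\<lambda>w. H w * (P w * (1 + w / 2))) has_field_derivative
       (H z * (P z * (1/2) + deriv P z * (1 + z/2)) + deriv H z * (P z * (1 + z/2)))) (at z)"
    by (rule DERIV_cong[OF DERIV_mult[OF dH DERIV_mult[OF dP dk]]]) (simp add: algebra_simps)
  hence "(F has_field_derivative
       (H z * (P z * (1/2) + deriv P z * (1 + z/2)) + deriv H z * (P z * (1 + z/2)))) (at z)"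
    by (rule has_field_derivative_transform_within_open[OF _ open_ball z]) (use FHP in auto)
  hence dF: "deriv F z = H z * (P z * (1/2) + deriv P z * (1 + z/2)) + deriv H z * (P z * (1 + z/2))"
    by (rule DERIV_imp_deriv)
  have k2: "2 + z \<noteq> 0" using nz(3) by (auto simp: field_simps)
  have "deriv F z / F z = deriv H z / H z + deriv P z / P z + (1/2) / (1 + z/2)"
  proof -
    have "(a * (b * (1/2) + b' * c) + a' * (b * c)) / (a * (b * c)) = a' / a + b' / b + (1/2) / c"
      if "a \<noteq> 0" "b \<noteq> 0" "c \<noteq> 0" for a b c a' b' :: complex
      using that by (simp add: field_simps)
    thus ?thesis unfolding dF FHP[OF z] using nz by blast
  qed
  also have "(1/2) / (1 + z/2) = 1 / (2 + z)" using nz(3) k2 by (simp add: field_simps)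
  finally have "log_deriv f z - 1 = z * deriv H z / H z + z * deriv P z / P z + z / (2 + z)"
    using log_deriv_factor[OF F(1,3) z] FG[OF z]
    by (simp only: times_divide_eq_right[symmetric]) (simp add: algebra_simps)
  also have "norm \<dots> \<le> norm (z * deriv H z / H z) + norm (z * deriv P z / P z) + norm (z / (2 + z))"
    by (intro order_trans[OF norm_triangle_ineq] add_mono) auto
  also have "\<dots> \<le> norm z / (1 - norm z) + 2 * norm z / (1 - (norm z)\<^sup>2) + norm z / (2 - norm z)"
  proof (intro add_mono)
    show "norm (z * deriv H z / H z) \<le> norm z / (1 - norm z)"
      by (rule norm_log_deriv_near_one[OF holH]) (use h hH z in \<open>auto simp: H_def F(2) G(2)\<close>)
    show "norm (z * deriv P z / P z) \<le> 2 * norm z / (1 - (norm z)\<^sup>2)"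
      by (rule norm_log_deriv_positive_real_part[OF holP]) (use p pP z in auto)
    have "norm (2 + z) \<ge> 2 - norm z"
      using norm_triangle_ineq2[of 2 "-z"] by simp
    thus "norm (z / (2 + z)) \<le> norm z / (2 - norm z)"
      using z by (auto simp: norm_divide intro!: divide_left_mono mult_pos_pos)
  qed
  finally show "norm (log_deriv f z - 1) \<le>
      norm z / (1 - norm z) + 2 * norm z / (1 - (norm z)\<^sup>2) + norm z / (2 - norm z)" .
qed

section \<open>Univalence of starlike functions\<close>

text \<open>The Noshiro-Warschawski criterion: on the segment from a to b, the real part of f/(b -
  a) has derivative Re f' > 0 and so increases strictly, which excludes f a = f b.\<close>

lemma inj_on_convex_Re_deriv_pos:
  assumes S: "convex S" and d: "\<And>z. z \<in> S \<Longrightarrow> (f has_field_derivative f' z) (at z)"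
    and pos: "\<And>z. z \<in> S \<Longrightarrow> Re (f' z) > 0"
  shows "inj_on f S"
proof (rule inj_onI, rule ccontr)
  fix a b assume ab: "a \<in> S" "b \<in> S" "f a = f b" "a \<noteq> b"
  define \<gamma> where "\<gamma> t = a + of_real t * (b - a)" for t :: real
  define \<phi> where "\<phi> t = Re (f (\<gamma> t) / (b - a))" for t
  have in_S: "\<gamma> t \<in> S" if "0 \<le> t" "t \<le> 1" for t
    using convexD_alt[OF S ab(1,2), of t] that
    by (simp add: \<gamma>_def scaleR_conv_of_real algebra_simps)
  have d\<phi>: "(\<phi> has_real_derivative Re (f' (\<gamma> t))) (at t)" if "0 \<le> t" "t \<le> 1" for t
  proof -
    have "(\<gamma> has_vector_derivative (b - a)) (at t)"
      unfolding \<gamma>_def by (auto intro!: derivative_eq_intros simp: scaleR_conv_of_real)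
    hence "((\<lambda>t. f (\<gamma> t)) has_vector_derivative (b - a) * f' (\<gamma> t)) (at t)"
      using field_vector_diff_chain_at[of \<gamma> "b - a" t f] d[OF in_S[OF that]] by (simp add: o_def)
    hence "((\<lambda>t. f (\<gamma> t) / (b - a)) has_vector_derivative (b - a) * f' (\<gamma> t) / (b - a)) (at t)"
      by (rule has_vector_derivative_divide)
    hence "(\<phi> has_vector_derivative Re ((b - a) * f' (\<gamma> t) / (b - a))) (at t)"
      unfolding \<phi>_def by (rule bounded_linear.has_vector_derivative[OF bounded_linear_Re])
    thus ?thesis using ab(4) by (simp add: has_real_derivative_iff_has_vector_derivative)
  qed
  hence "\<phi> 0 < \<phi> 1"
    using DERIV_pos_imp_increasing[of 0 1 \<phi>] d\<phi> pos[OF in_S] by (metis zero_less_one)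
  moreover have "\<phi> 0 = \<phi> 1" using ab(3) by (simp add: \<phi>_def \<gamma>_def)
  ultimately show False by simp
qed

text \<open>
  In the coordinate \<open>w = log z\<close> the function \<open>log f\<close> becomes \<open>L(w) = w + u(e\<^sup>w)\<close> on the left half-plane,
  with \<open>Re L' > 0\<close>, and \<open>L(w + 2\<pi>in) = L(w) + 2\<pi>in\<close>; so injectivity of \<open>L\<close> gives that of \<open>f\<close>.
\<close>
lemma starlike_imp_inj_on:
  assumes F: "F holomorphic_on unit_disk" and f: "\<And>z. z \<in> unit_disk \<Longrightarrow> f z = z * F z"
    and nz: "\<And>z. z \<in> unit_disk \<Longrightarrow> F z \<noteq> 0"
    and re: "\<And>z. z \<in> unit_disk \<Longrightarrow> Re (1 + z * deriv F z / F z) > 0"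
  shows "inj_on f unit_disk"
proof -
  \<comment> \<open>The disk is simply connected and \<open>F\<close> has no zeros, so
    \<open>F\<close> has a holomorphic logarithm.\<close>
  obtain u where u: "u holomorphic_on unit_disk" "\<And>z. z \<in> unit_disk \<Longrightarrow> F z = exp (u z)"
    using simply_connected_eq_holomorphic_log[of unit_disk] F nz
    by (metis convex_ball convex_imp_simply_connected open_ball)
  define H where "H = {w. Re w < 0}"
  define L where "L w = w + u (exp w)" for w
  have exp_H: "exp w \<in> unit_disk" if "w \<in> H" for w
    using that by (simp add: H_def)
  have du: "deriv u z = deriv F z / F z" if "z \<in> unit_disk" for z
  proof -
    have "((\<lambda>z. exp (u z)) has_field_derivative exp (u z) * deriv u z) (at z)"
      using holomorphic_derivI[OF u(1) open_ball that] by (auto intro!: derivative_eq_intros)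
    hence "(F has_field_derivative exp (u z) * deriv u z) (at z)"
      by (rule has_field_derivative_transform_within_open[OF _ open_ball that]) (use u(2) in auto)
    hence "deriv F z = exp (u z) * deriv u z" by (rule DERIV_imp_deriv)
    thus ?thesis using u(2)[OF that] by simp
  qed
  have "inj_on L H"
  proof (rule inj_on_convex_Re_deriv_pos)
    show "convex H" unfolding H_def by (rule convex_halfspace_Re_lt)
    fix w assume w: "w \<in> H"
    have "(u has_field_derivative deriv u (exp w)) (at (exp w))"
      using holomorphic_derivI[OF u(1) open_ball exp_H[OF w]] .
    hence "((\<lambda>w. u (exp w)) has_field_derivative deriv u (exp w) * exp w) (at w)"
      using DERIV_chain2 DERIV_exp by blast
    thus "(L has_field_derivative 1 + exp w * deriv F (exp w) / F (exp w)) (at w)"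
      unfolding L_def by (auto intro!: derivative_eq_intros simp: du[OF exp_H[OF w]])
    show "0 < Re (1 + exp w * deriv F (exp w) / F (exp w))"
      using re[OF exp_H[OF w]] .
  qed
  have fL: "f (exp w) = exp (L w)" if "w \<in> H" for w
    using f[OF exp_H[OF that]] u(2)[OF exp_H[OF that]] by (simp add: L_def exp_add)
  show ?thesis
  proof (rule inj_onI)
    fix x y assume xy: "x \<in> unit_disk" "y \<in> unit_disk" "f x = f y"
    show "x = y"
    proof (cases "x = 0 \<or> y = 0")
      case True
      thus ?thesis using xy f nz by (metis mult_eq_0_iff)
    next
      case False
      define w v where "w = Ln x" and "v = Ln y"
      have wv: "exp w = x" "exp v = y" using False by (auto simp: w_def v_def)
      have H: "w \<in> H" "v \<in> H"
        using False xy(1,2) by (auto simp: H_def w_def v_def)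
      have "exp (L w) = exp (L v)" using fL H wv xy(3) by metis
      then obtain n where n: "L w = L v + (of_int (2 * n) * pi) * \<i>"
        unfolding exp_eq by blast
      \<comment> \<open>Shifting \<open>v\<close> by the period that separates \<open>L w\<close>
        from \<open>L v\<close> keeps exp v and gives L v' = L w, so injectivity of \<open>L\<close>
        applies to the pair \<open>v'\<close>, \<open>w\<close>.\<close>
      define v' where "v' = v + (of_int (2 * n) * pi) * \<i>"
      have ev: "exp v' = exp v" unfolding exp_eq v'_def by blast
      have "v' \<in> H" using H by (simp add: H_def v'_def)
      moreover have "L v' = L w" using n by (simp add: L_def ev) (simp add: v'_def)
      ultimately have "v' = w" using \<open>inj_on L H\<close> H by (auto dest: inj_onD)
      thus ?thesis using ev wv by simp
    qed
  qed
qed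

section \<open>The cubic and its first positive root\<close>

definition radius_poly :: "real \<Rightarrow> real \<Rightarrow> real" where
  "radius_poly \<alpha> r = (3 - \<alpha>) * r^3 + (2 * \<alpha> - 1) * r^2 - (8 - \<alpha>) * r + 2 - 2 * \<alpha>"

text \<open>The cubic is the numerator left after clearing denominators. The denominator is positive
  on [0, 1), so the cubic carries the sign of the left-hand side.\<close>

lemma radius_poly_eq:
  assumes "0 \<le> r" "r < 1"
  shows "1 - \<alpha> - (r / (1 - r) + 2 * r / (1 - r\<^sup>2) + r / (2 - r))
     = radius_poly \<alpha> r / ((1 - r\<^sup>2) * (2 - r))"
proof -
  have eq: "1 - r\<^sup>2 = (1 - r) * (1 + r)" by (simp add: power2_eq_square algebra_simps)
  have "1 - r \<noteq> 0" "1 + r \<noteq> 0" "2 - r \<noteq> 0" using assms by auto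
  thus ?thesis unfolding eq radius_poly_def
    by (simp add: divide_simps) (simp add: power2_eq_square power3_eq_cube algebra_simps)
qed

text \<open>The cubic is 2 - 2 \<alpha> > 0 at 0 and -4 at 1, so its zero set in [0, 1] is nonempty;
  being compact, this set has a least element.\<close>

lemma ex_smallest_positive_root:
  assumes "\<alpha> < 1"
  shows "\<exists>R. smallest_positive_root (radius_poly \<alpha>) R"
proof -
  define Z where "Z = {r \<in> {0..1}. radius_poly \<alpha> r = 0}"
  have cont: "continuous_on A (radius_poly \<alpha>)" for A
    unfolding radius_poly_def by (intro continuous_intros)
  have p0: "radius_poly \<alpha> 0 > 0" and p1: "radius_poly \<alpha> 1 < 0"
    using assms by (auto simp: radius_poly_def)
  have "\<exists>x\<ge>0. x \<le> 1 \<and> radius_poly \<alpha> x = 0"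
    by (rule IVT2') (use p0 p1 cont in auto)
  hence ne: "Z \<noteq> {}" by (auto simp: Z_def)
  have "Z = {0..1} \<inter> radius_poly \<alpha> -` {0}" by (auto simp: Z_def)
  moreover have "closed ({0..1} \<inter> radius_poly \<alpha> -` {0})"
    by (intro continuous_closed_preimage cont) auto
  ultimately have "compact Z"
    by (metis compact_Icc compact_Int_closed inf.left_idem)
  then obtain R where R: "R \<in> Z" "\<And>s. s \<in> Z \<Longrightarrow> R \<le> s"
    using compact_attains_inf[of Z] ne by blast
  have "R \<noteq> 0" using R(1) p0 by (auto simp: Z_def)
  moreover have "R \<le> s" if "s > 0" "radius_poly \<alpha> s = 0" for s
    using R that by (cases "s \<le> 1") (auto simp: Z_def)
  ultimately show ?thesis
    using R(1) unfolding Z_def smallest_positive_root_def by (intro exI[of _ R]) auto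
qed

lemma smallest_positive_root_radius_poly:
  assumes "\<alpha> < 1" and R: "smallest_positive_root (radius_poly \<alpha>) R"
  shows "0 < R" "R < 1" "radius_poly \<alpha> R = 0"
    "\<And>r. 0 \<le> r \<Longrightarrow> r < R \<Longrightarrow> radius_poly \<alpha> r > 0"
proof -
  have cont: "continuous_on A (radius_poly \<alpha>)" for A
    unfolding radius_poly_def by (intro continuous_intros)
  have p0: "radius_poly \<alpha> 0 > 0" and p1: "radius_poly \<alpha> 1 < 0"
    using assms by (auto simp: radius_poly_def)
  show R0: "0 < R" "radius_poly \<alpha> R = 0" using R by (auto simp: smallest_positive_root_def)
  have least: "R \<le> s" if "s > 0" "radius_poly \<alpha> s = 0" for s
    using R that by (auto simp: smallest_positive_root_def)
  have first: "radius_poly \<alpha> r > 0" if "0 \<le> r" "r < R" for r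
  \<comment> \<open>A value \<le> 0 at \<open>r\<close> would produce a root in (0, r], earlier than
    \<open>R\<close>.\<close>
  proof (rule ccontr)
    assume "\<not> radius_poly \<alpha> r > 0"
    hence "\<exists>x\<ge>0. x \<le> r \<and> radius_poly \<alpha> x = 0"
      by (intro IVT2') (use p0 that cont in auto)
    then obtain x where "0 \<le> x" "x \<le> r" "radius_poly \<alpha> x = 0" by blast
    thus False using least[of x] p0 that by (cases "x = 0") auto
  qed
  thus "\<And>r. 0 \<le> r \<Longrightarrow> r < R \<Longrightarrow> radius_poly \<alpha> r > 0" .
  show "R < 1"
    using first[of 1] p1 R0 by (cases "R = 1"; cases "R > 1") auto
qed

section \<open>The extremal function\<close>

text \<open>The product of z + z^2/2, h = 1 + z and p = (1 + z)/(1 - z).\<close>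

definition F2_extremal :: "complex \<Rightarrow> complex" where
  "F2_extremal z = z * ((1 + z / 2) * (1 + z)\<^sup>2 / (1 - z))"

lemma F2_extremal_in_class_F2: "F2_extremal \<in> class_F2"
proof -
  \<comment> \<open>This is p (z + z^2/2), so that f/g = 1 + z and the other quotient is the Cayley
    map.\<close>
  define g where "g z = z * ((1 + z / 2) * (1 + z) / (1 - z))" for z :: complex
  have ne: "1 - z \<noteq> 0" "1 + z \<noteq> 0" "1 + z / 2 \<noteq> 0" if "norm z < 1" for z :: complex
  proof -
    show "1 - z \<noteq> 0" "1 + z \<noteq> 0" using that by (auto simp: add_eq_0_iff)
    show "1 + z / 2 \<noteq> 0"
    proof
      assume "1 + z / 2 = 0"
      hence "z = -2" by (simp add: eq_neg_iff_add_eq_0 field_simps)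
      thus False using that by simp
    qed
  qed
  have g: "g \<in> normalized_analytic"
    by (rule normalized_analyticI[of "\<lambda>z. (1 + z / 2) * (1 + z) / (1 - z)"])
       (auto simp: g_def ne intro!: holomorphic_intros)
  have f: "F2_extremal \<in> normalized_analytic"
    by (rule normalized_analyticI[of "\<lambda>z. (1 + z / 2) * (1 + z)\<^sup>2 / (1 - z)"])
       (auto simp: F2_extremal_def ne intro!: holomorphic_intros)
  have q1: "ext_quotient F2_extremal g z = 1 + z" if "norm z < 1" for z
    using ne[OF that] by (auto simp: ext_quotient_def F2_extremal_def g_def power2_eq_square)
  have q2: "ext_quotient g (\<lambda>z. z + z\<^sup>2 / 2) z = (1 + z) / (1 - z)" if "norm z < 1" for z
  proof (cases "z = 0")
    case False
    have "z + z\<^sup>2 / 2 = z * (1 + z / 2)" by (simp add: power2_eq_square algebra_simps)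
    thus ?thesis using False ne[OF that] by (simp add: ext_quotient_def g_def)
  qed (simp add: ext_quotient_def)
  have "\<forall>z\<in>unit_disk. norm (ext_quotient F2_extremal g z - 1) < 1 \<and>
      Re (ext_quotient g (\<lambda>z. z + z\<^sup>2 / 2) z) > 0"
    using q1 q2 Re_cayley_pos by simp
  thus ?thesis using f g unfolding class_F2_def by blast
qed

text \<open>At a negative real point all three terms of the logarithmic derivative are negative real
  and of the largest allowed modulus, so nothing is lost in the triangle inequality.\<close>

lemma log_deriv_F2_extremal:
  assumes R: "0 < R" "R < 1"
  shows "log_deriv F2_extremal (- of_real R) =
     of_real (1 - (R / (1 - R) + 2 * R / (1 - R\<^sup>2) + R / (2 - R)))"
proof -
  define z where "z = - complex_of_real R"
  have ne: "1 - z \<noteq> 0" "1 + z \<noteq> 0" "2 + z \<noteq> 0"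
    using R by (auto simp: z_def complex_eq_iff)
  define F where "F z = (1 + z / 2) * (1 + z)\<^sup>2 / (1 - z)" for z :: complex
  have nz: "1 - w \<noteq> 0" if "w \<in> unit_disk" for w :: complex using that by auto
  have F: "F holomorphic_on unit_disk"
    unfolding F_def by (intro holomorphic_intros nz) auto
  have k: "1 + z / 2 \<noteq> 0" using ne(3) by (simp add: field_simps)
  have F_ne: "F z \<noteq> 0" using ne k by (simp add: F_def)
  have "(F has_field_derivative
      (((1/2) * (1 + z)\<^sup>2 + (1 + z / 2) * (2 * (1 + z))) / (1 - z) + (1 + z / 2) * (1 + z)\<^sup>2 / (1 - z)\<^sup>2)) (at z)"
    unfolding F_def using ne(1)
    by (auto intro!: derivative_eq_intros simp: divide_simps)
       (auto simp: power2_eq_square algebra_simps)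
  hence "deriv F z / F z = (((1/2) * (1 + z)\<^sup>2 + (1 + z / 2) * (2 * (1 + z))) / (1 - z)
      + (1 + z / 2) * (1 + z)\<^sup>2 / (1 - z)\<^sup>2) / ((1 + z / 2) * (1 + z)\<^sup>2 / (1 - z))"
    by (simp only: F_def DERIV_imp_deriv)
  also have "\<dots> = (1/2) / (1 + z / 2) + 2 / (1 + z) + 1 / (1 - z)"
  proof -
    have "(((1/2) * a\<^sup>2 + c * (2 * a)) / b + c * a\<^sup>2 / b\<^sup>2) / (c * a\<^sup>2 / b) = (1/2) / c + 2 / a + 1 / b"
      if "a \<noteq> 0" "b \<noteq> 0" "c \<noteq> 0" for a b c :: complex
      using that by (simp add: field_simps power2_eq_square)
    thus ?thesis using ne k by blast
  qed
  also have "(1/2) / (1 + z / 2) = 1 / (2 + z)" using ne(3) k by (simp add: field_simps)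
  \<comment> \<open>Of the two copies of 1/(1 + z), one belongs to h; the other joins 1/(1 - z) to
    form the term of p.\<close>
  also have "1 / (2 + z) + 2 / (1 + z) + 1 / (1 - z) = 1 / (1 + z) + 2 / ((1 - z) * (1 + z)) + 1 / (2 + z)"
    using ne by (simp add: divide_simps) (simp add: algebra_simps)
  finally have dF: "deriv F z / F z = 1 / (1 + z) + 2 / ((1 - z) * (1 + z)) + 1 / (2 + z)" .
  have "log_deriv F2_extremal z = 1 + z * deriv F z / F z"
    by (rule log_deriv_factor[OF F _ _ F_ne]) (use R in \<open>auto simp: F2_extremal_def F_def z_def\<close>)
  also have "\<dots> = 1 + z / (1 + z) + 2 * z / ((1 - z) * (1 + z)) + z / (2 + z)"
    unfolding times_divide_eq_right[symmetric] dF by (simp add: distrib_left)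
  also have "(1 - z) * (1 + z) = 1 - z\<^sup>2" by (simp add: power2_eq_square algebra_simps)
  finally show ?thesis by (simp add: z_def)
qed

section \<open>Criteria for the radius\<close>

text \<open>The condition \<open>in_G\<close> gives the lower bound, because below \<open>R\<close>
  the estimate for the class stays strictly under 1 - \<alpha>. The condition \<open>omits\<close>
  gives the upper bound, because a dilation of \<open>F2_extremal\<close> by r > R attains \<alpha>
  inside the disk.\<close>

lemma radius_eqI:
  assumes \<alpha>: "\<alpha> < 1"
    and in_G: "\<And>f. f \<in> normalized_analytic \<Longrightarrow> (\<And>z. z \<in> unit_disk \<Longrightarrow> z \<noteq> 0 \<Longrightarrow> f z \<noteq> 0) \<Longrightarrow>
          (\<And>z. z \<in> unit_disk \<Longrightarrow> norm (log_deriv f z - 1) < 1 - \<alpha>) \<Longrightarrow> f \<in> G"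
    and omits: "\<And>f z. f \<in> G \<Longrightarrow> z \<in> unit_disk \<Longrightarrow> log_deriv f z \<noteq> of_real \<alpha>"
    and R: "smallest_positive_root (radius_poly \<alpha>) R"
  shows "radius G class_F2 = R"
proof (rule antisym)
  note R = smallest_positive_root_radius_poly[OF \<alpha> R]
  have log_deriv_scale: "log_deriv (\<lambda>z. f (of_real r * z) / of_real r) z = log_deriv f (of_real r * z)"
    if f: "f holomorphic_on unit_disk" and r: "0 < r" "r < 1" and z: "z \<in> unit_disk" for f r z
  proof -
    have rz: "of_real r * z \<in> unit_disk"
      using r z mult_strict_mono[of r 1 "norm z" 1] by (simp add: norm_mult)
    have "((\<lambda>z. f (of_real r * z)) has_field_derivative deriv f (of_real r * z) * of_real r) (at z)"
      by (rule DERIV_chain2[of f _ "\<lambda>z. of_real r * z", OF holomorphic_derivI[OF f open_ball rz]])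
         (auto intro!: derivative_eq_intros)
    hence "((\<lambda>z. f (of_real r * z) / of_real r) has_field_derivative
             deriv f (of_real r * z) * of_real r / of_real r) (at z)"
      by (rule DERIV_cdivide)
    hence "deriv (\<lambda>z. f (of_real r * z) / of_real r) z = deriv f (of_real r * z)"
      using r by (simp add: DERIV_imp_deriv)
    thus ?thesis using r by (simp add: log_deriv_def)
  qed
  show "R \<le> radius G class_F2"
  proof (rule radius_upper, unfold radius_admissible_def, intro conjI ballI allI impI)
    show "0 \<le> R" "R \<le> 1" using R(1,2) by simp_all
    fix f r assume f: "f \<in> class_F2" and r: "0 < r \<and> r < R"
    define h where "h z = f (of_real r * z) / of_real r" for z
    have fn: "f \<in> normalized_analytic" using f by (simp add: class_F2_def)
    obtain F where F: "F holomorphic_on unit_disk" "F 0 = 1" "\<And>z. f z = z * F z"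
      using normalized_analytic_factor[OF fn] by blast
    have rz: "norm (of_real r * z) < R" "of_real r * z \<in> unit_disk" if "z \<in> unit_disk" for z
      using r R(2) that mult_strict_mono[of r R "norm z" 1] by (auto simp: norm_mult)
    have "h \<in> normalized_analytic"
    proof (rule normalized_analyticI)
      show "(\<lambda>z. F (of_real r * z)) holomorphic_on unit_disk"
        by (rule holomorphic_on_compose_gen[OF _ F(1), unfolded o_def])
           (use rz in \<open>auto intro!: holomorphic_intros\<close>)
    qed (use r F in \<open>auto simp: h_def\<close>)
    moreover have "h z \<noteq> 0" if "z \<in> unit_disk" "z \<noteq> 0" for z
      using class_F2_log_deriv_bound(1)[OF f rz(2)[OF that(1)]] r that by (simp add: h_def)
    moreover have "norm (log_deriv h z - 1) < 1 - \<alpha>" if z: "z \<in> unit_disk" for z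
    proof -
      define s where "s = norm (of_real r * z)"
      have s: "0 \<le> s" "s < R" using rz[OF z] by (auto simp: s_def)
      have s1: "s < 1" using s R by simp
      have "log_deriv h z = log_deriv f (of_real r * z)"
        unfolding h_def by (rule log_deriv_scale) (use fn r R z in \<open>auto simp: normalized_analytic_def\<close>)
      hence "norm (log_deriv h z - 1) \<le> s / (1 - s) + 2 * s / (1 - s\<^sup>2) + s / (2 - s)"
        using class_F2_log_deriv_bound(2)[OF f rz(2)[OF z]] by (simp add: s_def)
      moreover have "s\<^sup>2 < 1" using s(1) s1 by (simp add: power_less_one_iff)
      hence "radius_poly \<alpha> s / ((1 - s\<^sup>2) * (2 - s)) > 0"
        using R(4)[OF s] s1 by simp
      ultimately show ?thesis using radius_poly_eq[OF s(1) s1, of \<alpha>] by linarith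
    qed
    ultimately show "(\<lambda>z. f (of_real r * z) / of_real r) \<in> G"
      using in_G[of h] by (simp add: h_def[abs_def])
  qed
  show "radius G class_F2 \<le> R"
  proof (rule ccontr)
    assume "\<not> radius G class_F2 \<le> R"
    hence lt: "R < radius G class_F2" by simp
    \<comment> \<open>Any number strictly between \<open>R\<close> and the supposed larger radius is
      admissible and below 1; the midpoint serves.\<close>
    define r where "r = (R + radius G class_F2) / 2"
    have adm: "radius_admissible G class_F2 (radius G class_F2)" by (rule radius_admissible_radius)
    hence r: "R < r" "r < radius G class_F2" "r < 1" "0 < r"
      using lt R(1) by (auto simp: r_def radius_admissible_def)
    \<comment> \<open>The dilation by \<open>r\<close> carries this point to -R; there the
      logarithmic derivative of \<open>F2_extremal\<close> is \<alpha>, since the cubic vanishes at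
      \<open>R\<close>.\<close>
    define z where "z = - complex_of_real (R / r)"
    have z: "z \<in> unit_disk" using r R(1) by (simp add: z_def norm_divide)
    have "log_deriv (\<lambda>z. F2_extremal (of_real r * z) / of_real r) z = log_deriv F2_extremal (of_real r * z)"
      by (rule log_deriv_scale)
         (use F2_extremal_in_class_F2 r z in \<open>auto simp: class_F2_def normalized_analytic_def\<close>)
    also have "of_real r * z = - of_real R" using r by (simp add: z_def)
    also have "log_deriv F2_extremal (- of_real R) = of_real \<alpha>"
      using radius_poly_eq[of R \<alpha>] R(1-3)
      by (subst log_deriv_F2_extremal) (simp_all only: of_real_eq_iff, simp_all)
    finally have "log_deriv (\<lambda>z. F2_extremal (of_real r * z) / of_real r) z = of_real \<alpha>" .
    moreover have "(\<lambda>z. F2_extremal (of_real r * z) / of_real r) \<in> G"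
      using adm F2_extremal_in_class_F2 r by (auto simp: radius_admissible_def)
    ultimately show False using omits z by blast
  qed
qed

text \<open>The disk D(1, 1 - \<alpha>) lies in the half-plane Re w > \<alpha>. As \<alpha> \<ge> 0,
  univalence follows from \<open>starlike_imp_inj_on\<close>.\<close>

lemma radius_starlike_of_order:
  assumes \<alpha>: "0 \<le> \<alpha>" "\<alpha> < 1" and R: "smallest_positive_root (radius_poly \<alpha>) R"
  shows "radius (starlike_of_order \<alpha>) class_F2 = R"
proof (rule radius_eqI[OF \<alpha>(2) _ _ R])
  fix f assume f: "f \<in> normalized_analytic" "\<And>z. z \<in> unit_disk \<Longrightarrow> z \<noteq> 0 \<Longrightarrow> f z \<noteq> 0"
    and bd: "\<And>z. z \<in> unit_disk \<Longrightarrow> norm (log_deriv f z - 1) < 1 - \<alpha>"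
  have re: "Re (log_deriv f z) > \<alpha>" if "z \<in> unit_disk" for z
    using bd[OF that] abs_Re_le_cmod[of "log_deriv f z - 1"] by simp
  obtain F where F: "F holomorphic_on unit_disk" "F 0 = 1" "\<And>z. f z = z * F z"
    using normalized_analytic_factor[OF f(1)] by blast
  have nz: "F z \<noteq> 0" if "z \<in> unit_disk" for z
    using f(2)[OF that] F(2,3) by (cases "z = 0") auto
  have "inj_on f unit_disk"
  proof (rule starlike_imp_inj_on[OF F(1,3) nz])
    fix z assume z: "z \<in> unit_disk"
    show "0 < Re (1 + z * deriv F z / F z)"
      using re[OF z] log_deriv_factor[OF F(1,3) z nz[OF z]] \<alpha>(1) by simp
  qed
  thus "f \<in> starlike_of_order \<alpha>"
    using f re by (simp add: starlike_of_order_def univalent_class_def)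
next
  fix f z assume "f \<in> starlike_of_order \<alpha>" "z \<in> unit_disk"
  hence "Re (log_deriv f z) > \<alpha>" by (simp add: starlike_of_order_def)
  thus "log_deriv f z \<noteq> of_real \<alpha>" by auto
qed

text \<open>The map \<psi> is the right inverse of \<phi> in the shifted variable x = w - 1, which
  centres the disk at 0.\<close>

lemma radius_starlike_class:
  assumes \<alpha>: "0 \<le> \<alpha>" "\<alpha> < 1"
    and \<phi>: "\<phi> holomorphic_on unit_disk" "\<And>z. z \<in> unit_disk \<Longrightarrow> \<phi> z \<noteq> of_real \<alpha>"
    and \<psi>: "\<psi> holomorphic_on ball 0 (1 - \<alpha>)" "\<psi> 0 = 0"
      "\<And>x. norm x < 1 - \<alpha> \<Longrightarrow> norm (\<psi> x) < 1" "\<And>x. norm x < 1 - \<alpha> \<Longrightarrow> \<phi> (\<psi> x) = 1 + x"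
  shows "radius (starlike_class \<phi>) class_F2 = radius (starlike_of_order \<alpha>) class_F2"
proof -
  obtain R where R: "smallest_positive_root (radius_poly \<alpha>) R"
    using ex_smallest_positive_root[OF \<alpha>(2)] by blast
  have "radius (starlike_class \<phi>) class_F2 = R"
  proof (rule radius_eqI[OF \<alpha>(2) _ _ R])
    fix f assume f: "f \<in> normalized_analytic" "\<And>z. z \<in> unit_disk \<Longrightarrow> z \<noteq> 0 \<Longrightarrow> f z \<noteq> 0"
      and bd: "\<And>z. z \<in> unit_disk \<Longrightarrow> norm (log_deriv f z - 1) < 1 - \<alpha>"
    \<comment> \<open>This is the Schwarz function of the subordination; it vanishes at 0 because
      \<open>log_deriv f\<close> is 1 there.\<close>
    define \<omega> where "\<omega> z = \<psi> (log_deriv f z - 1)" for z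
    have hol: "log_deriv f holomorphic_on unit_disk" using log_deriv_holomorphic[OF f] .
    have "\<omega> holomorphic_on unit_disk" unfolding \<omega>_def
      by (rule holomorphic_on_compose_gen[OF _ \<psi>(1), unfolded o_def])
         (use bd in \<open>auto intro!: holomorphic_intros hol\<close>)
    moreover have "\<omega> ` unit_disk \<subseteq> unit_disk" "\<omega> 0 = 0" "\<forall>z\<in>unit_disk. log_deriv f z = \<phi> (\<omega> z)"
      using \<psi> bd by (auto simp: \<omega>_def) (simp add: log_deriv_def \<psi>(2))
    ultimately show "f \<in> starlike_class \<phi>"
      using f(1) hol \<phi>(1) unfolding starlike_class_def subordinate_def by blast
  next
    fix f z assume "f \<in> starlike_class \<phi>" "z \<in> unit_disk"
    thus "log_deriv f z \<noteq> of_real \<alpha>"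
      using \<phi>(2) unfolding starlike_class_def subordinate_def by fastforce
  qed
  thus ?thesis using radius_starlike_of_order[OF \<alpha> R] by simp
qed

section \<open>The individual classes\<close>

text \<open>Integration of the derivative bound along the ray from 0 to z. It compares
  \<open>Ln (1 + x)\<close> and \<open>Arcsin\<close> with the real functions -ln (1 - t) and arcsin
  t.\<close>

lemma norm_le_majorant:
  fixes F F' :: "complex \<Rightarrow> complex"
  assumes F: "\<And>w. norm w \<le> norm z \<Longrightarrow> (F has_field_derivative F' w) (at w)"
    and g: "\<And>t. 0 \<le> t \<Longrightarrow> t \<le> norm z \<Longrightarrow> (g has_real_derivative g' t) (at t)"
    and le: "\<And>w. norm w \<le> norm z \<Longrightarrow> norm (F' w) \<le> g' (norm w)"
  shows "norm (F z - F 0) \<le> g (norm z) - g 0"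
proof -
  define f \<phi> where "f t = F (of_real t * z)" and "\<phi> t = g (t * norm z)" for t
  have tz: "norm (of_real t * z) \<le> norm z" "0 \<le> t * norm z" "t * norm z \<le> norm z"
    if "0 \<le> t" "t \<le> 1" for t
    using that mult_right_mono[of t 1 "norm z"] by (auto simp: norm_mult)
  have df: "(f has_vector_derivative z * F' (of_real t * z)) (at t)" if "0 \<le> t" "t \<le> 1" for t
  proof -
    have "((\<lambda>t. of_real t * z) has_vector_derivative z) (at t)"
      by (auto intro!: derivative_eq_intros simp: scaleR_conv_of_real)
    from field_vector_diff_chain_at[OF this, of F] F[OF tz(1)[OF that]]
    show ?thesis by (simp add: f_def[abs_def] o_def)
  qed
  have dp: "(\<phi> has_vector_derivative g' (t * norm z) * norm z) (at t)" if "0 \<le> t" "t \<le> 1" for t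
    unfolding \<phi>_def has_real_derivative_iff_has_vector_derivative[symmetric]
    by (rule DERIV_chain2[of g _ "\<lambda>t. t * norm z", OF g[OF tz(2,3)[OF that]]]) (auto intro!: derivative_eq_intros)
  have "norm (f 1 - f 0) \<le> \<phi> 1 - \<phi> 0"
  proof (rule differentiable_bound_general)
    show "continuous_on {0..1} f" "continuous_on {0..1} \<phi>"
      using df dp by (auto intro!: continuous_at_imp_continuous_on has_vector_derivative_continuous)
    fix t :: real assume t: "0 < t" "t < 1"
    show "(f has_vector_derivative z * F' (of_real t * z)) (at t)"
         "(\<phi> has_vector_derivative g' (t * norm z) * norm z) (at t)"
      using df dp t by auto
    show "norm (z * F' (of_real t * z)) \<le> g' (t * norm z) * norm z"
      using le[of "of_real t * z"] tz(1)[of t] t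
      by (simp add: norm_mult mult.commute mult_left_mono)
  qed simp
  thus ?thesis by (simp add: f_def \<phi>_def)
qed

text \<open>The inverse is \<open>Ln (1 + x)\<close>, and |Ln (1 + x)| \<le> -ln (1 - |x|) < 1 as
  soon as 1 - |x| > 1/e. The value 1/e forces Re z = -1.\<close>

lemma radius_exp:
  "radius (starlike_class phi_exp) class_F2 = radius (starlike_of_order (1 / exp 1)) class_F2"
proof (rule radius_starlike_class[where \<psi> = "\<lambda>x. Ln (1 + x)"])
  show "phi_exp holomorphic_on unit_disk"
    unfolding phi_exp_def[abs_def] by (intro holomorphic_intros)
  show "phi_exp z \<noteq> of_real (1 / exp 1)" if "z \<in> unit_disk" for z
  proof
    assume "phi_exp z = of_real (1 / exp 1)"
    hence "norm (exp z) = exp (-1)" by (simp add: phi_exp_def exp_minus norm_divide inverse_eq_divide)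
    hence "Re z = -1" by simp
    thus False using that abs_Re_le_cmod[of z] by simp
  qed
  have pos: "Re (1 + x) > 0" if "norm x < 1" for x :: complex
    using abs_Re_le_cmod[of x] that by simp
  have nonpos: "1 + x \<notin> \<real>\<^sub>\<le>\<^sub>0" if "norm x < 1" for x :: complex
    using pos[OF that] by (fastforce simp: complex_nonpos_Reals_iff)
  have lt1: "norm x < 1" if "norm x < 1 - 1 / exp 1" for x :: complex
    using that by (smt (verit) divide_pos_pos exp_gt_zero)
  show "(\<lambda>x. Ln (1 + x)) holomorphic_on ball 0 (1 - 1 / exp 1)"
    by (intro holomorphic_intros nonpos lt1) auto
  show "norm (Ln (1 + x)) < 1" if x: "norm x < 1 - 1 / exp 1" for x :: complex
  proof -
    have "norm (Ln (1 + x) - Ln (1 + 0)) \<le> - ln (1 - norm x) - (- ln (1 - 0))"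
    proof (rule norm_le_majorant)
      fix w :: complex assume "norm w \<le> norm x"
      hence w: "norm w < 1" using lt1[OF x] by simp
      show "((\<lambda>x. Ln (1 + x)) has_field_derivative 1 / (1 + w)) (at w)"
        using nonpos[OF w] by (auto intro!: derivative_eq_intros simp: divide_inverse)
      have "norm (1 + w) \<ge> 1 - norm w" using norm_triangle_ineq2[of 1 "-w"] by simp
      thus "norm (1 / (1 + w)) \<le> 1 / (1 - norm w)"
        using w by (simp add: norm_divide frac_le)
    next
      fix t assume "0 \<le> t" "t \<le> norm x"
      hence "t < 1" using lt1[OF x] by simp
      thus "((\<lambda>t. - ln (1 - t)) has_real_derivative 1 / (1 - t)) (at t)"
        by (auto intro!: derivative_eq_intros)
    qed
    moreover have "ln (exp (-1)) < ln (1 - norm x)"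
      using x lt1[OF x] by (subst ln_less_cancel_iff) (auto simp: exp_minus inverse_eq_divide)
    ultimately show ?thesis by simp
  qed
  show "phi_exp (Ln (1 + x)) = 1 + x" if "norm x < 1 - 1 / exp 1" for x
    unfolding phi_exp_def using pos[OF lt1[OF that]] by (metis exp_Ln less_irrefl zero_complex.sel(1))
qed auto

text \<open>Completing the square gives \<phi>(z) = 1/3 + (2/3) (z + 1)^2, whence both the inverse
  and the only preimage -1 of 1/3.\<close>

lemma radius_cardioid:
  "radius (starlike_class phi_cardioid) class_F2 = radius (starlike_of_order (1/3)) class_F2"
proof (rule radius_starlike_class[where \<psi> = "\<lambda>x. csqrt (1 + 3 / 2 * x) - 1"])
  show "phi_cardioid holomorphic_on unit_disk"
    unfolding phi_cardioid_def[abs_def] by (intro holomorphic_intros) auto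
  show "phi_cardioid z \<noteq> of_real (1/3)" if "z \<in> unit_disk" for z
  proof
    assume "phi_cardioid z = of_real (1/3)"
    moreover have "phi_cardioid z - 1 / 3 = 2 / 3 * (z + 1)\<^sup>2"
      by (simp add: phi_cardioid_def power2_eq_square field_simps)
    ultimately have "(z + 1)\<^sup>2 = 0" by simp
    hence "z = -1" by (simp add: add_eq_0_iff2)
    thus False using that by simp
  qed
  have *: "Re (1 + 3 / 2 * x) > 0" if "norm x < 2/3" for x :: complex
    using abs_Re_le_cmod[of x] that by simp
  have nonpos: "1 + 3 / 2 * x \<notin> \<real>\<^sub>\<le>\<^sub>0" if "norm x < 2/3" for x :: complex
    using * that by (fastforce simp: complex_nonpos_Reals_iff)
  show "(\<lambda>x. csqrt (1 + 3 / 2 * x) - 1) holomorphic_on ball 0 (1 - 1/3)"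
    by (intro holomorphic_intros nonpos) auto
  fix x :: complex assume x: "norm x < 1 - 1/3"
  define c where "c = csqrt (1 + 3 / 2 * x)"
  have c2: "c\<^sup>2 = 1 + 3 / 2 * x" by (simp add: c_def)
  \<comment> \<open>The principal root keeps |c + 1| \<ge> 1, so |c - 1| is at most |c^2 - 1| =
    (3/2) |x| < 1.\<close>
  have "Re c \<ge> 0" using csqrt_principal[of "1 + 3 / 2 * x"] by (auto simp: c_def)
  hence "1 \<le> norm (c + 1)" using complex_Re_le_cmod[of "c + 1"] by simp
  hence "norm (c - 1) * 1 \<le> norm (c - 1) * norm (c + 1)" by (intro mult_left_mono) auto
  also have "\<dots> = norm ((c - 1) * (c + 1))" by (simp add: norm_mult)
  also have "(c - 1) * (c + 1) = 3 / 2 * x"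
    using c2 by (simp add: power2_eq_square algebra_simps)
  also have "norm \<dots> < 1" using x by (simp add: norm_mult)
  finally show "norm (csqrt (1 + 3 / 2 * x) - 1) < 1" by (simp add: c_def)
  have "phi_cardioid (c - 1) = 1 / 3 + 2 / 3 * c\<^sup>2"
    by (simp add: phi_cardioid_def power2_eq_square field_simps)
  also have "\<dots> = 1 + x" unfolding c2 by (simp add: field_simps)
  finally show "phi_cardioid (csqrt (1 + 3 / 2 * x) - 1) = 1 + x" by (simp add: c_def)
qed auto

text \<open>The inverse is \<open>Arcsin\<close> on the disk of radius sin 1, where |Arcsin x| \<le>
  arcsin |x| < 1.\<close>

lemma radius_sin:
  "radius (starlike_class phi_sin) class_F2 = radius (starlike_of_order (1 - sin 1)) class_F2"
proof (rule radius_starlike_class[where \<psi> = Arcsin])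
  have "(1::real) < pi / 2" using pi_gt3 by simp
  hence sin1: "0 < sin (1::real)" "sin (1::real) < 1"
    using sin_gt_zero[of 1] sin_monotone_2pi[of 1 "pi/2"] by auto
  thus "0 \<le> 1 - sin (1::real)" "1 - sin (1::real) < 1" by auto
  show "phi_sin holomorphic_on unit_disk"
    unfolding phi_sin_def[abs_def] by (intro holomorphic_intros)
  show "phi_sin z \<noteq> of_real (1 - sin 1)" if "z \<in> unit_disk" for z
  proof
    assume "phi_sin z = of_real (1 - sin 1)"
    hence "sin z = sin (-1)" using sin_of_real[of 1, where 'a = complex]
      by (simp add: phi_sin_def)
    then obtain n where z: "z = -1 + of_real (2 * n * pi) \<or> z = 1 + of_real ((2 * n + 1) * pi)"
        and n: "n \<in> \<int>"
      unfolding complex_sin_eq by auto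
    obtain m where m: "n = of_int m" using n by (auto elim: Ints_cases)
    define y where "y = of_int m * pi"
    have ny: "2 * n * pi = 2 * y" "(2 * n + 1) * pi = 2 * y + pi"
      by (simp_all add: y_def m algebra_simps)
    \<comment> \<open>Both families of solutions of sin z = sin (-1) avoid the strip |Re z| <
      1.\<close>
    have "Re z = -1 + 2 * y \<or> Re z = 1 + (2 * y + pi)"
      using z unfolding ny by auto
    moreover have "\<bar>Re z\<bar> < 1" using abs_Re_le_cmod[of z] that by simp
    moreover have "y \<ge> pi \<or> y = 0 \<or> y \<le> - pi"
    proof -
      consider "m \<ge> 1" | "m = 0" | "m \<le> -1" by linarith
      thus ?thesis
      proof cases
        case 3
        thus ?thesis using mult_right_mono[of "of_int m" "-1" pi] by (simp add: y_def)
      qed (auto simp: y_def)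
    qed
    ultimately show False using pi_gt3 by linarith
  qed
  show "Arcsin holomorphic_on ball 0 (1 - (1 - sin 1))"
  proof (rule holomorphic_on_Arcsin)
    fix z :: complex assume "z \<in> ball 0 (1 - (1 - sin 1))"
    thus "\<bar>Re z\<bar> < 1" using abs_Re_le_cmod[of z] sin1 by simp
  qed
  fix x :: complex assume x: "norm x < 1 - (1 - sin 1)"
  have "norm (Arcsin x - Arcsin 0) \<le> arcsin (norm x) - arcsin 0"
  proof (rule norm_le_majorant)
    fix w :: complex assume "norm w \<le> norm x"
    hence w: "norm w < 1" using x sin1 by simp
    have "\<bar>Re w\<bar> < 1" using abs_Re_le_cmod[of w] w by simp
    thus "(Arcsin has_field_derivative inverse (cos (Arcsin w))) (at w)"
      by (intro has_field_derivative_Arcsin)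
    \<comment> \<open>The squared modulus of the cosine is |1 - w^2| \<ge> 1 - |w|^2, which bounds
      the derivative of \<open>Arcsin\<close> by that of the real arcsin at |w|.\<close>
    have "(norm (cos (Arcsin w)))\<^sup>2 = norm (1 - w\<^sup>2)"
      by (simp flip: norm_power add: cos_squared_eq)
    also have "\<dots> \<ge> 1 - (norm w)\<^sup>2"
      using norm_triangle_ineq2[of 1 "w\<^sup>2"] by (simp add: norm_power)
    finally have "sqrt (1 - (norm w)\<^sup>2) \<le> norm (cos (Arcsin w))"
      by (simp add: real_le_lsqrt)
    moreover have "1 - (norm w)\<^sup>2 > 0" using w by (simp add: power_less_one_iff)
    ultimately show "norm (inverse (cos (Arcsin w))) \<le> inverse (sqrt (1 - (norm w)\<^sup>2))"
      by (simp add: norm_inverse le_imp_inverse_le)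
  next
    fix t assume "0 \<le> t" "t \<le> norm x"
    thus "(arcsin has_real_derivative inverse (sqrt (1 - t\<^sup>2))) (at t)"
      using x sin1 by (intro DERIV_arcsin) auto
  qed
  also have "arcsin (norm x) < arcsin (sin 1)"
    using x sin1 norm_ge_zero[of x] by (intro arcsin_less_arcsin) linarith+
  also have "arcsin (sin 1) = 1" using \<open>1 < pi / 2\<close> by (intro arcsin_sin) auto
  finally show "norm (Arcsin x) < 1" by simp
  show "phi_sin (Arcsin x) = 1 + x" by (simp add: phi_sin_def)
qed auto

text \<open>Squaring w - z = sqrt (1 + z^2) and solving for z gives z = (w^2 - 1)/(2 w), with w = 1
  + x.\<close>

lemma radius_lune:
  "radius (starlike_class phi_lune) class_F2 = radius (starlike_of_order (sqrt 2 - 1)) class_F2"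
proof (rule radius_starlike_class[where \<psi> = "\<lambda>x. ((1 + x)\<^sup>2 - 1) / (2 * (1 + x))"])
  have sqrt2: "1 < sqrt 2" "sqrt 2 < 2" by (auto simp: real_less_rsqrt real_less_lsqrt)
  thus "0 \<le> sqrt 2 - 1" "sqrt 2 - 1 < 1" by auto
  have "1 + z\<^sup>2 \<notin> \<real>\<^sub>\<le>\<^sub>0" if "norm z < 1" for z :: complex
  proof -
    have "norm (z\<^sup>2) < 1" using that by (simp add: norm_power power_less_one_iff)
    hence "Re (1 + z\<^sup>2) > 0" using abs_Re_le_cmod[of "z\<^sup>2"] by simp
    thus ?thesis by (fastforce simp: complex_nonpos_Reals_iff)
  qed
  thus "phi_lune holomorphic_on unit_disk"
    unfolding phi_lune_def[abs_def] by (intro holomorphic_intros) auto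
  show "phi_lune z \<noteq> of_real (sqrt 2 - 1)" if "z \<in> unit_disk" for z
  proof
    define a where "a = complex_of_real (sqrt 2 - 1)"
    assume "phi_lune z = of_real (sqrt 2 - 1)"
    hence "csqrt (1 + z\<^sup>2) = a - z" unfolding a_def[symmetric] phi_lune_def by (simp add: algebra_simps)
    hence "1 + z\<^sup>2 = (a - z)\<^sup>2" by (metis power2_csqrt)
    hence "2 * a * z = a\<^sup>2 - 1" by (simp add: power2_eq_square algebra_simps)
    also have "a\<^sup>2 - 1 = of_real ((sqrt 2 - 1)\<^sup>2 - 1)" by (simp add: a_def)
    also have "(sqrt 2 - 1)\<^sup>2 - 1 = - 2 * (sqrt 2 - 1)" by (simp add: power2_diff)
    also have "of_real (- 2 * (sqrt 2 - 1)) = 2 * a * (-1)" by (simp add: a_def)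
    finally have "2 * a * z = 2 * a * (-1)" .
    moreover have "a \<noteq> 0" using sqrt2 unfolding a_def of_real_eq_0_iff by simp
    ultimately have "z = -1" unfolding mult_cancel_left by simp
    thus False using that by simp
  qed
  have lt1: "norm x < 1" if "norm x < 1 - (sqrt 2 - 1)" for x :: complex
    using that sqrt2 by linarith
  have re: "Re (1 + x) > 0" if "norm x < 1 - (sqrt 2 - 1)" for x :: complex
    using abs_Re_le_cmod[of x] lt1[OF that] by simp
  have ne: "1 + x \<noteq> 0" if "norm x < 1 - (sqrt 2 - 1)" for x :: complex
    using re[OF that] by (metis less_irrefl zero_complex.sel(1))
  show "(\<lambda>x. ((1 + x)\<^sup>2 - 1) / (2 * (1 + x))) holomorphic_on ball 0 (1 - (sqrt 2 - 1))"
  proof (intro holomorphic_intros)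
    fix x :: complex assume "x \<in> ball 0 (1 - (sqrt 2 - 1))"
    hence "1 + x \<noteq> 0" using ne by simp
    thus "2 * (1 + x) \<noteq> 0" unfolding mult_eq_0_iff by simp
  qed
  fix x :: complex assume x: "norm x < 1 - (sqrt 2 - 1)"
  define w t where "w = 1 + x" and "t = norm x"
  have w: "w \<noteq> 0" "Re w > 0" using ne[OF x] re[OF x] by (auto simp: w_def)
  have t: "0 \<le> t" "t < 1" "t < 2 - sqrt 2" using x lt1[OF x] by (auto simp: t_def)
  define z where "z = (w\<^sup>2 - 1) / (2 * w)"
  have "norm w \<ge> 1 - t" using norm_triangle_ineq2[of 1 "-x"] by (simp add: w_def t_def)
  hence "norm (1 + 1 / w) \<le> 1 + 1 / (1 - t)"
    using t by (intro order_trans[OF norm_triangle_ineq]) (simp add: norm_divide frac_le)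
  hence "t * norm (1 + 1 / w) \<le> t * (1 + 1 / (1 - t))" using t by (intro mult_left_mono)
  also have "z = x * (1 + 1 / w) / 2"
  proof -
    have "w\<^sup>2 - 1 = x * (w + 1)" by (simp add: w_def power2_eq_square algebra_simps)
    thus ?thesis using w by (simp add: z_def field_simps)
  qed
  hence "t * norm (1 + 1 / w) = 2 * norm z"
    by (simp only: norm_mult norm_divide t_def) simp
  finally have "2 * norm z \<le> t * (1 + 1 / (1 - t))" .
  moreover have "t * (1 + 1 / (1 - t)) < 2"
  proof -
    \<comment> \<open>The radius 2 - sqrt 2 enters here: t < 2 - sqrt 2 means (2 - t)^2 > 2, which
      rearranges to the next line.\<close>
    have "(sqrt 2)\<^sup>2 < (2 - t)\<^sup>2" using t by (intro power_strict_mono) auto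
    hence "t * (2 - t) < 2 * (1 - t)" by (simp add: power2_eq_square algebra_simps)
    moreover have "t * (1 + 1 / (1 - t)) = t * (2 - t) / (1 - t)" using t by (simp add: field_simps)
    ultimately show ?thesis using t by (simp add: divide_less_eq)
  qed
  ultimately show "norm (((1 + x)\<^sup>2 - 1) / (2 * (1 + x))) < 1"
    by (simp add: z_def w_def)
  \<comment> \<open>This form shows Re (w - z) > 0, so w - z is the principal root of 1 + z^2 and
    not its negative.\<close>
  have wz: "w - z = (w + 1 / w) / 2" using w by (simp add: z_def field_simps power2_eq_square)
  have "(Re w)\<^sup>2 + (Im w)\<^sup>2 > 0" using w(2) by (simp add: sum_power2_gt_zero_iff)
  hence "Re (1 / w) > 0" using w(2) by (simp add: Re_divide)
  hence "Re (w - z) > 0" unfolding wz using w by simp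
  hence "csqrt ((w - z)\<^sup>2) = w - z" by (intro csqrt_square) auto
  moreover have "(w - z)\<^sup>2 = 1 + z\<^sup>2" using w
    by (simp add: z_def field_simps power2_eq_square)
  ultimately have "phi_lune z = w" by (simp add: phi_lune_def)
  thus "phi_lune (((1 + x)\<^sup>2 - 1) / (2 * (1 + x))) = 1 + x" by (simp add: z_def w_def)
qed auto

text \<open>The radius 1 - \<alpha> = 3 - 2 sqrt 2 equals 1/k^2. This identity makes -1 a double
  root of \<phi>(z) = \<alpha> and puts the smaller root of \<phi>(z) = 1 + x in the unit
  disk.\<close>

lemma radius_rational:
  "radius (starlike_class phi_rational) class_F2
     = radius (starlike_of_order (2 * (sqrt 2 - 1))) class_F2"
proof -
  define \<kappa> where "\<kappa> = sqrt 2 + 1"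
  define k where "k = complex_of_real \<kappa>"
  define c where "c = 1 - 2 * (sqrt 2 - 1)"
  have sq2: "sqrt 2 * sqrt 2 = 2" by simp
  have \<kappa>: "\<kappa> > 2" "\<kappa>\<^sup>2 = 2 * \<kappa> + 1" "\<kappa>\<^sup>2 * c = 1"
    using real_less_rsqrt[of 1 2] sq2
    by (auto simp: \<kappa>_def c_def power2_eq_square algebra_simps)
  have k2: "k\<^sup>2 = 2 * k + 1" unfolding k_def of_real_power[symmetric] \<kappa>(2) by simp
  have k2c: "k\<^sup>2 * of_real c = 1"
    unfolding k_def of_real_power[symmetric] of_real_mult[symmetric] \<kappa>(3) by simp
  have k0: "k \<noteq> 0" using \<kappa> by (simp add: k_def)
  have phi: "phi_rational z = 1 + (k * z + z\<^sup>2) / (k\<^sup>2 - k * z)" for z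
    by (simp add: phi_rational_def k_def \<kappa>_def Let_def)
  have c: "0 < c" "c < 1" "4 * c = (1 - c)\<^sup>2"
  proof -
    have "sqrt 2 < 3 / 2" by (rule real_less_lsqrt) (auto simp: power2_eq_square)
    thus "0 < c" by (simp add: c_def)
    show "c < 1" using real_less_rsqrt[of 1 2] by (simp add: c_def)
    show "4 * c = (1 - c)\<^sup>2" using sq2 by (simp add: c_def power2_eq_square algebra_simps)
  qed
  have den: "k\<^sup>2 - k * z \<noteq> 0" if "norm z < 1" for z :: complex
  proof
    assume "k\<^sup>2 - k * z = 0"
    hence "k * (k - z) = 0" by (simp add: power2_eq_square algebra_simps)
    hence "z = k" using k0 by simp
    thus False using that \<kappa>(1) by (simp add: k_def)
  qed
  \<comment> \<open>The discriminant of the quadratic for z, divided by (k (1 + x))^2. Since 4 c =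
    (1 - c)^2, it stays in the right half-plane for |x| < c.\<close>
  define v :: "complex \<Rightarrow> complex" where "v x = 1 + 4 * x / (1 + x)\<^sup>2" for x :: complex
  \<comment> \<open>The equation \<open>\<phi>(z) = 1 + x\<close> is \<open>z\<^sup>2 + k (1 + x) z - k\<^sup>2 x = 0\<close>; \<open>\<psi> x\<close> is its root of smaller modulus,
    and the product of the roots has modulus \<open>k\<^sup>2 \<bar>x\<bar> < k\<^sup>2 c = 1\<close>.\<close>
  define \<psi> :: "complex \<Rightarrow> complex" where "\<psi> x = k / 2 * (1 + x) * (csqrt (v x) - 1)" for x
  have ne: "1 + x \<noteq> 0" and v_re: "Re (v x) > 0" if "norm x < c" for x :: complex
  proof -
    have nx: "norm (1 + x) \<ge> 1 - norm x" using norm_triangle_ineq2[of 1 "-x"] by simp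
    thus "1 + x \<noteq> 0" using that c by auto
    have "(1 - c)\<^sup>2 < (norm (1 + x))\<^sup>2" using nx that c by (intro power_strict_mono) auto
    hence "4 * norm x < (norm (1 + x))\<^sup>2" using c that by simp
    hence "norm (4 * x / (1 + x)\<^sup>2) < 1"
      using \<open>1 + x \<noteq> 0\<close> by (simp add: norm_divide norm_mult norm_power)
    thus "Re (v x) > 0"
      using abs_Re_le_cmod[of "4 * x / (1 + x)\<^sup>2"] unfolding v_def by (simp del: norm_divide)
  qed
  show ?thesis
  proof (rule radius_starlike_class[where \<psi> = \<psi>])
    show "0 \<le> 2 * (sqrt 2 - 1)" "2 * (sqrt 2 - 1) < 1" using c by (auto simp: c_def)
    show "phi_rational holomorphic_on unit_disk"
      unfolding phi[abs_def] by (intro holomorphic_intros) (use den in auto)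
    show "phi_rational z \<noteq> of_real (2 * (sqrt 2 - 1))" if z: "z \<in> unit_disk" for z
    proof
      assume "phi_rational z = of_real (2 * (sqrt 2 - 1))"
      hence "(k * z + z\<^sup>2) / (k\<^sup>2 - k * z) = - of_real c"
        unfolding phi c_def by (simp add: algebra_simps)
      hence "k * z + z\<^sup>2 = - of_real c * (k\<^sup>2 - k * z)"
        using den[of z] z by (simp add: divide_eq_eq)
      hence "k\<^sup>2 * (k * z + z\<^sup>2) = - (k\<^sup>2 * of_real c) * (k\<^sup>2 - k * z)" by simp
      hence "k * (k\<^sup>2 * z + k * z\<^sup>2 + k - z) = 0"
        unfolding k2c by (simp add: power2_eq_square algebra_simps)
      moreover have "k\<^sup>2 * z + k * z\<^sup>2 + k - z = k * (2 * z + z\<^sup>2 + 1)"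
        unfolding k2 by (simp add: algebra_simps)
      ultimately have "k * (2 * z + z\<^sup>2 + 1) = 0" using k0 by simp
      hence "2 * z + z\<^sup>2 + 1 = 0" using k0 by simp
      hence "(z + 1)\<^sup>2 = 0" by (simp add: power2_eq_square algebra_simps)
      hence "z = -1" by (simp add: add_eq_0_iff2)
      thus False using z by simp
    qed
    show "\<psi> holomorphic_on ball 0 (1 - 2 * (sqrt 2 - 1))"
      unfolding \<psi>_def v_def c_def[symmetric]
    proof (intro holomorphic_intros)
      show "1 + 4 * x / (1 + x)\<^sup>2 \<notin> \<real>\<^sub>\<le>\<^sub>0" if "x \<in> ball 0 c" for x :: complex
        using v_re[of x] that by (fastforce simp: v_def complex_nonpos_Reals_iff)
    qed (use ne in auto)
    show "\<psi> 0 = 0" by (simp add: \<psi>_def v_def)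
    fix x :: complex assume "norm x < 1 - 2 * (sqrt 2 - 1)"
    hence x: "norm x < c" by (simp add: c_def)
    define s where "s = csqrt (v x)"
    have s2: "(1 + x)\<^sup>2 * s\<^sup>2 = (1 + x)\<^sup>2 + 4 * x" using ne[OF x] by (simp add: s_def v_def field_simps)
    have "Re s \<ge> 0" using csqrt_principal[of "v x"] by (auto simp: s_def)
    define z1 z2 where "z1 = \<psi> x" and "z2 = k / 2 * (1 + x) * (- s - 1)"
    have "z1 * z2 = - (k\<^sup>2 / 4) * ((1 + x)\<^sup>2 * s\<^sup>2 - (1 + x)\<^sup>2)"
    proof -
      have "(k / 2 * p * (s - 1)) * (k / 2 * p * (- s - 1)) = - (k\<^sup>2 / 4) * (p\<^sup>2 * s\<^sup>2 - p\<^sup>2)" for p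
        by (simp add: power2_eq_square field_simps)
      thus ?thesis by (simp only: z1_def z2_def \<psi>_def s_def[symmetric])
    qed
    also have "\<dots> = - k\<^sup>2 * x" unfolding s2 by simp
    finally have prod: "z1 * z2 = - k\<^sup>2 * x" .
    have sum: "z1 + z2 = - k * (1 + x)"
      by (simp add: z1_def z2_def \<psi>_def s_def[symmetric] field_simps)
    \<comment> \<open>With Re s \<ge> 0, \<open>s\<close> is at least as close to 1 as to -1; hence
      |z1| \<le> |z2|.\<close>
    have "(norm (s - 1))\<^sup>2 \<le> (norm (s + 1))\<^sup>2"
      using \<open>Re s \<ge> 0\<close> unfolding cmod_power2 by (simp add: power2_eq_square algebra_simps)
    hence "norm (s - 1) \<le> norm (- s - 1)"
      using power2_le_imp_le[of "norm (s - 1)" "norm (s + 1)"] norm_minus_cancel[of "s + 1"] by simp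
    hence "norm z1 \<le> norm z2"
      unfolding z1_def z2_def \<psi>_def s_def[symmetric] norm_mult by (intro mult_left_mono) auto
    hence "norm z1 * norm z1 \<le> norm (z1 * z2)" unfolding norm_mult by (intro mult_left_mono) auto
    also have "\<dots> = \<kappa>\<^sup>2 * norm x"
      unfolding prod using \<kappa>(1) by (simp add: norm_mult norm_power k_def)
    also have "\<dots> < \<kappa>\<^sup>2 * c" using x \<kappa>(1) by simp
    finally have "(norm z1)\<^sup>2 < 1" using \<kappa>(3) by (simp add: power2_eq_square)
    thus lt: "norm (\<psi> x) < 1" by (simp add: z1_def abs_square_less_1)
    have "z1 * (z1 + z2) = z1\<^sup>2 + z1 * z2" by (simp add: power2_eq_square algebra_simps)
    hence "k * z1 + z1\<^sup>2 = x * (k\<^sup>2 - k * z1)" unfolding sum prod by (simp add: algebra_simps)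
    thus "phi_rational (\<psi> x) = 1 + x"
      using den[OF lt] by (simp add: phi z1_def divide_eq_eq)
  qed
qed

section \<open>Even functions of a square root and the parabolic class\<close>

lemma sqrt_less_iff:
  assumes "r > 0"
  shows "sqrt x < r \<longleftrightarrow> x < r\<^sup>2"
  using assms by (metis abs_of_pos real_sqrt_abs real_sqrt_less_iff)

lemma even_function_csqrt_square:
  assumes "E (- s) = E s"
  shows "E (csqrt (s\<^sup>2)) = E s"
proof -
  have "csqrt (s\<^sup>2) = s \<or> csqrt (s\<^sup>2) = - s" by (metis power2_csqrt power2_eq_iff)
  thus ?thesis using assms by auto
qed

text \<open>Off the negative axis \<open>csqrt\<close> is holomorphic; off the positive axis
  \<open>\<i> * csqrt (- z)\<close> is a holomorphic square root, equal to \<open>csqrt z\<close> up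
  to sign, which evenness ignores. Continuity then removes the singularity at 0.\<close>

lemma even_function_csqrt_holomorphic:
  assumes r: "r > 0" and E: "E holomorphic_on ball 0 r"
    and even: "\<And>s. norm s < r \<Longrightarrow> E (- s) = E s"
  shows "(\<lambda>z. E (csqrt z)) holomorphic_on ball 0 (r\<^sup>2)"
proof (rule no_isolated_singularity'[of "{0}"])
  define A B where "A = ball (0::complex) (r\<^sup>2) - \<real>\<^sub>\<le>\<^sub>0" and "B = ball (0::complex) (r\<^sup>2) - \<real>\<^sub>\<ge>\<^sub>0"
  have op: "open A" "open B" by (auto simp: A_def B_def intro!: open_Diff)
  have "(\<lambda>z. E (csqrt z)) holomorphic_on A"
  proof (rule holomorphic_on_compose_gen[OF _ E, unfolded o_def])
    show "csqrt holomorphic_on A"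
      by (rule holomorphic_on_subset[OF holomorphic_on_csqrt]) (auto simp: A_def)
  qed (use r in \<open>auto simp: A_def sqrt_less_iff\<close>)
  moreover have "(\<lambda>z. E (csqrt z)) holomorphic_on B"
  proof -
    have nonpos: "- z \<notin> \<real>\<^sub>\<le>\<^sub>0" if "z \<in> B" for z
      using that by (auto simp: B_def complex_nonneg_Reals_iff complex_nonpos_Reals_iff)
    have "(\<lambda>z. E (\<i> * csqrt (- z))) holomorphic_on B"
    proof (rule holomorphic_on_compose_gen[OF _ E, unfolded o_def])
      show "(\<lambda>z. \<i> * csqrt (- z)) holomorphic_on B"
        by (intro holomorphic_intros nonpos)
    qed (use r in \<open>auto simp: B_def norm_mult sqrt_less_iff\<close>)
    moreover have "E (\<i> * csqrt (- z)) = E (csqrt z)" if "z \<in> B" for z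
      using even_function_csqrt_square[of E "\<i> * csqrt (- z)", OF even] that r
      by (simp add: power_mult_distrib norm_mult sqrt_less_iff B_def)
    ultimately show ?thesis by (rule holomorphic_transform)
  qed
  ultimately have "(\<lambda>z. E (csqrt z)) holomorphic_on A \<union> B" using op by (intro holomorphic_on_Un)
  moreover have "ball 0 (r\<^sup>2) - {0} = A \<union> B"
    using r by (auto simp: A_def B_def complex_nonneg_Reals_iff complex_nonpos_Reals_iff complex_eq_iff)
  ultimately show "(\<lambda>z. E (csqrt z)) holomorphic_on ball 0 (r\<^sup>2) - {0}" by simp
  have "(csqrt \<longlongrightarrow> 0) (at 0)"
  proof (rule tendstoI)
    fix e :: real assume e: "e > 0"
    hence "\<forall>z. norm z < e\<^sup>2 \<longrightarrow> norm (csqrt z) < e" using sqrt_less_iff[OF e] by simp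
    thus "\<forall>\<^sub>F z in at 0. dist (csqrt z) 0 < e"
      unfolding eventually_at using e by (intro exI[of _ "e\<^sup>2"]) auto
  qed
  moreover have "isCont E 0"
    using holomorphic_on_imp_continuous_on[OF E] r by (simp add: continuous_on_eq_continuous_at)
  ultimately have "((\<lambda>z. E (csqrt z)) \<longlongrightarrow> E 0) (at 0)"
    by (rule isCont_tendsto_compose[rotated])
  thus "((\<lambda>z. E (csqrt z)) \<longlongrightarrow> E (csqrt z)) (at z within ball 0 (r\<^sup>2))" if "z \<in> {0}" for z
    using that by (auto intro: tendsto_within_subset[OF _ subset_UNIV])
qed auto

text \<open>The map \<open>T\<close>, which is tanh^2 (l/2), inverts the squared logarithm
  \<open>L\<close>: if (1 + s)/(1 - s) = e^l then s = tanh (l/2). Both functions are even, so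
  composing them with square roots is harmless.\<close>

lemma radius_parabolic:
  "radius (starlike_class phi_parabolic) class_F2 = radius (starlike_of_order (1/2)) class_F2"
proof -
  define L where "L s = (Ln ((1 + s) / (1 - s)))\<^sup>2" for s :: complex
  define T where "T l = ((exp l - 1) / (exp l + 1))\<^sup>2" for l :: complex
  define c where "c = complex_of_real (pi\<^sup>2 / 2)"
  define \<psi> where "\<psi> x = T (csqrt (c * x))" for x
  have c0: "c \<noteq> 0" by (simp add: c_def)
  have phi: "phi_parabolic z = 1 + L (csqrt z) / c" for z
    by (simp add: phi_parabolic_def L_def c_def)
  have nonpos: "(1 + s) / (1 - s) \<notin> \<real>\<^sub>\<le>\<^sub>0" if "norm s < 1" for s :: complex
    using Re_cayley_pos[OF that] by (auto simp: complex_nonpos_Reals_iff)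
  have L_even: "L (- s) = L s" if "norm s < 1" for s
  proof -
    have "(1 - s) / (1 + s) = inverse ((1 + s) / (1 - s))" by (simp add: field_simps)
    thus ?thesis unfolding L_def using Ln_inverse[OF nonpos[OF that]] by simp
  qed
  have holL: "L holomorphic_on ball 0 1"
    unfolding L_def by (intro holomorphic_intros nonpos) auto
  have Re_exp_pos: "Re (exp l) > 0" if "norm l < pi / 2" for l
  proof -
    have "\<bar>Im l\<bar> < pi / 2" using abs_Im_le_cmod[of l] that by simp
    thus ?thesis unfolding Re_exp by (intro mult_pos_pos cos_gt_zero_pi) auto
  qed
  have T_even: "T (- l) = T l" for l
  proof -
    have "(exp (- l) - 1) / (exp (- l) + 1) = (1 - exp l) / (1 + exp l)"
      by (simp add: exp_minus divide_simps)
    also have "\<dots> = - ((exp l - 1) / (exp l + 1))"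
      by (simp add: add.commute minus_divide_left)
    finally show ?thesis by (simp add: T_def)
  qed
  have holT: "T holomorphic_on ball 0 (pi / 2)"
    unfolding T_def
  proof (intro holomorphic_intros)
    fix l :: complex assume "l \<in> ball 0 (pi / 2)"
    hence "Re (exp l + 1) > 0" using Re_exp_pos[of l] by simp
    thus "exp l + 1 \<noteq> 0" by (metis less_irrefl zero_complex.sel(1))
  qed
  \<comment> \<open>The radius 1/2 enters here: it gives |l| < \<pi>/2 for l =
    \<open>csqrt (c * x)\<close>, hence Re (e^l) > 0, and the Cayley transform of e^l lies in the
    disk.\<close>
  have norm_c: "norm (c * x) < (pi / 2)\<^sup>2" if "norm x < 1 / 2" for x
    using that by (simp add: c_def norm_mult power_divide norm_power)
  show ?thesis
  proof (rule radius_starlike_class[where \<psi> = \<psi>])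
    have "(\<lambda>z. L (csqrt z)) holomorphic_on ball 0 (1\<^sup>2)"
      by (rule even_function_csqrt_holomorphic) (use holL L_even in auto)
    thus "phi_parabolic holomorphic_on unit_disk"
      unfolding phi[abs_def] using c0 by (intro holomorphic_intros) auto
    show "phi_parabolic z \<noteq> of_real (1 / 2)" if z: "z \<in> unit_disk" for z
    proof
      assume "phi_parabolic z = of_real (1 / 2)"
      moreover define s where "s = csqrt z"
      \<comment> \<open>The value 1/2 would need a logarithm equal to i \<pi>/2 up to sign, but (1 +
        s)/(1 - s) lies in the open right half-plane, where |Im Ln| < \<pi>/2.\<close>
      ultimately have "L s = - (c / 2)" using c0 by (simp add: phi field_simps eq_neg_iff_add_eq_0)
      also have "\<dots> = (\<i> * of_real (pi / 2))\<^sup>2" by (simp add: c_def power_mult_distrib power_divide)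
      finally have "Ln ((1 + s) / (1 - s)) = \<i> * of_real (pi / 2) \<or>
                    Ln ((1 + s) / (1 - s)) = - (\<i> * of_real (pi / 2))"
        unfolding L_def power2_eq_iff .
      hence "Im (Ln ((1 + s) / (1 - s))) = pi / 2 \<or> Im (Ln ((1 + s) / (1 - s))) = - (pi / 2)"
        by (rule disj_forward) (simp_all only:, simp_all)
      moreover have "norm s < 1" using z by (simp add: s_def sqrt_less_iff)
      hence "\<bar>Im (Ln ((1 + s) / (1 - s)))\<bar> < pi / 2"
        using Re_cayley_pos[of s] Re_Ln_pos_lt[of "(1 + s) / (1 - s)"] by fastforce
      ultimately show False by auto
    qed
    have "(\<lambda>z. T (csqrt z)) holomorphic_on ball 0 ((pi / 2)\<^sup>2)"
      by (rule even_function_csqrt_holomorphic) (use holT T_even in auto)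
    thus "\<psi> holomorphic_on ball 0 (1 - 1 / 2)"
      unfolding \<psi>_def
      by (rule holomorphic_on_compose_gen[rotated, unfolded o_def])
         (use norm_c in \<open>auto intro!: holomorphic_intros\<close>)
    show "\<psi> 0 = 0" by (simp add: \<psi>_def T_def)
    fix x :: complex assume "norm x < 1 - 1 / 2"
    hence x: "norm x < 1 / 2" by simp
    define l where "l = csqrt (c * x)"
    define s where "s = (exp l - 1) / (exp l + 1)"
    have l: "norm l < pi / 2" using sqrt_less_iff[OF pi_half_gt_zero] norm_c[OF x]
      unfolding l_def norm_csqrt by blast
    have \<psi>: "\<psi> x = s\<^sup>2" by (simp add: \<psi>_def T_def l_def s_def)
    have s: "norm s < 1" unfolding s_def by (rule norm_cayley_less_1[OF Re_exp_pos[OF l]])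
    thus "norm (\<psi> x) < 1" unfolding \<psi> by (simp add: norm_power power_less_one_iff)
    have "Re (exp l + 1) > 0" using Re_exp_pos[OF l] by simp
    hence ne: "exp l + 1 \<noteq> 0" by (metis less_irrefl zero_complex.sel(1))
    hence "1 + s = 2 * exp l / (exp l + 1)" "1 - s = 2 / (exp l + 1)"
      by (simp_all add: s_def field_simps)
    hence "(1 + s) / (1 - s) = exp l" using ne by simp
    moreover have "Ln (exp l) = l"
      using abs_Im_le_cmod[of l] l pi_gt_zero by (intro Ln_exp) linarith+
    ultimately have "L s = c * x" by (simp add: L_def l_def)
    thus "phi_parabolic (\<psi> x) = 1 + x"
      \<comment> \<open>The root \<open>csqrt (s^2)\<close> may be -s instead of s; \<open>L\<close>
        takes the same value at both.\<close>
      unfolding phi \<psi> using even_function_csqrt_square[of L s] L_even[OF s] c0 by simp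
  qed auto
qed

theorem theorem3p1:
  "(\<forall>\<alpha>::real. 0 \<le> \<alpha> \<and> \<alpha> < 1 \<longrightarrow>
      smallest_positive_root
        (\<lambda>r. (3 - \<alpha>) * r^3 + (2 * \<alpha> - 1) * r^2 - (8 - \<alpha>) * r + 2 - 2 * \<alpha>)
        (radius (starlike_of_order \<alpha>) class_F2)) \<and>
   radius (starlike_class phi_parabolic) class_F2 = radius (starlike_of_order (1/2)) class_F2 \<and>
   radius (starlike_class phi_exp) class_F2 = radius (starlike_of_order (1 / exp 1)) class_F2 \<and>
   radius (starlike_class phi_sin) class_F2 = radius (starlike_of_order (1 - sin 1)) class_F2 \<and>
   radius (starlike_class phi_lune) class_F2 = radius (starlike_of_order (sqrt 2 - 1)) class_F2 \<and>
   radius (starlike_class phi_rational) class_F2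
     = radius (starlike_of_order (2 * (sqrt 2 - 1))) class_F2 \<and>
   radius (starlike_class phi_cardioid) class_F2 = radius (starlike_of_order (1/3)) class_F2"
proof (intro conjI allI impI)
  fix \<alpha> :: real assume "0 \<le> \<alpha> \<and> \<alpha> < 1"
  hence \<alpha>: "0 \<le> \<alpha>" "\<alpha> < 1" by auto
  obtain R where R: "smallest_positive_root (radius_poly \<alpha>) R"
    using ex_smallest_positive_root[OF \<alpha>(2)] by blast
  thus "smallest_positive_root
        (\<lambda>r. (3 - \<alpha>) * r^3 + (2 * \<alpha> - 1) * r^2 - (8 - \<alpha>) * r + 2 - 2 * \<alpha>)
        (radius (starlike_of_order \<alpha>) class_F2)"
    unfolding radius_starlike_of_order[OF \<alpha> R] radius_poly_def[abs_def] .
qed (fact radius_parabolic radius_exp radius_sin radius_lune radius_rational radius_cardioid)+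

end
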